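(* Let $(M,F)$ be a Finsler space with Chern-Rund connection ${}^{ch}\nabla$ and average Chern-Rund connection $\langle{}^{ch}\nabla\rangle$, an affine connection on $M$. Then the torsion $T_{\langle{}^{ch}\nabla\rangle}$ is zero.
   Context: The summation convention is used. $M$ is an $n$-dimensional smooth manifold, $\hat\pi:N=TM\setminus\{0\}\to M$ is the slit tangent bundle, and local coordinates $(x^i)$ on $M$ induce natural coordinates $(x^i,y^i)$ on $TM$. A Finsler space $(M,F)$ is a manifold $M$ with a function $F:TM\to[0,\infty)$ that is smooth on $N$, satisfies $F(x,\lambda y)=\lambda F(x,y)$ for $\lambda\ge 0$, and for which $g_{ij}(x,y):=\frac12\frac{\partial^2F^2}{\partial y^i\partial y^j}$ is positive definite on $N$. Put $A_{ijk}=\frac F2\frac{\partial g_{ij}}{\partial y^k}$, $A^i_{jk}=g^{il}A_{ljk}$, $\gamma^i_{jk}=\frac12g^{is}\big(\frac{\partial g_{sj}}{\partial x^k}-\frac{\partial g_{jk}}{\partial x^s}+\frac{\partial g_{sk}}{\partial x^j}\big)$, and define $N^i_j$ by $\frac{N^i_j}{F}=\gamma^i_{jk}\frac{y^k}{F}-A^i_{jk}\gamma^k_{rs}\frac{y^r}{F}\frac{y^s}{F}$. Put $\frac{\delta}{\delta x^j}=\frac{\partial}{\partial x^j}-N^i_j\frac{\partial}{\partial y^i}$ and $\delta y^i=dy^i+N^i_jdx^j$. The horizontal lift at $u\in\hat\pi^{-1}(x)$ is $\iota_u\big(X^i\frac{\partial}{\partial x^i}\big)=X^i\frac{\delta}{\delta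 x^i}|_u$. $\hat\pi^*TM\to N$ is the pull-back bundle, with fiber over $u$ canonically identified with $T_{\hat\pi(u)}M$ through $\pi_2:\hat\pi^*TM\to TM$. $\hat\pi^*Y$ is the pull-back section of a vector field $Y$. The Chern-Rund connection is the unique linear connection on $\hat\pi^*TM$ whose connection 1-forms $\omega^i_j$ satisfy $d(dx^i)-dx^j\wedge\omega^i_j=0$ and $dg_{ij}-g_{kj}\omega^k_i-g_{ik}\omega^k_j=2A_{ijk}\frac{\delta y^k}{F}$. Equivalently $\omega^i_j=\Gamma^i_{jk}(x,y)\,dx^k$ with $\Gamma^i_{jk}=\Gamma^i_{kj}$, together with the second equation. The indicatrix is $I_x=\{y\in T_xM:F(x,y)=1\}$. Its volume form $dvol_x$ is the pull-back to $I_x$ of the contraction of $\sqrt{\det g}\,\frac{\delta y^1}{F}\wedge\cdots\wedge\frac{\delta y^n}{F}$ with $l=\frac{y^i}{F}\frac{\partial}{\partial y^i}$ ($I_x$ is oriented so that $dvol_x$ is positive). Put $vol(I_x)=\int_{I_x}dvol_x$ and $\langle f\rangle(x)=\frac1{vol(I_x)}\int_{I_x}f\,dvol_x$. The average of a linear connection $\nabla$ on $\hat\pi^*TM$ is the affine connection on $M$ given by $\langle\nabla\rangle_XY=\langle\pi_2(\nabla_{\iota_u(X)}\hat\pi^*Y)\rangle$ (average over $u\in I_x$, for $X\in T_xM$, $Y\in\Gamma TM$). *)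

theory Defs
  imports "HOL-Analysis.Analysis"
begin

subsection \<open>Smooth manifolds, tangent vectors and vector fields\<close>

text \<open>Continuous differentiability of order \<open>k\<close> and smoothness; meant for open \<open>S\<close>.\<close>

primrec Ck_on :: "nat \<Rightarrow> 'a::euclidean_space set \<Rightarrow> ('a \<Rightarrow> 'b::real_normed_vector) \<Rightarrow> bool" where
  "Ck_on 0 S f \<longleftrightarrow> continuous_on S f"
| "Ck_on (Suc k) S f \<longleftrightarrow>
     f differentiable_on S \<and> (\<forall>v. Ck_on k S (\<lambda>x. frechet_derivative f (at x) v))"

definition smooth_on :: "'a::euclidean_space set \<Rightarrow> ('a \<Rightarrow> 'b::real_normed_vector) \<Rightarrow> bool" where
  "smooth_on S f \<longleftrightarrow> (\<forall>k. Ck_on k S f)"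

text \<open>A chart is a domain together with a coordinate map; the values of the coordinate map
  outside the domain are irrelevant.\<close>

type_synonym ('m, 'a) chart = "'m set \<times> ('m \<Rightarrow> 'a)"

definition chart_inv :: "('m, 'a) chart \<Rightarrow> 'a \<Rightarrow> 'm" where
  "chart_inv c = inv_into (fst c) (snd c)"

definition chart_range :: "('m, 'a) chart \<Rightarrow> 'a set" where
  "chart_range c = snd c ` fst c"

definition smooth_manifold :: "'m topology \<Rightarrow> ('m, 'a::euclidean_space) chart set \<Rightarrow> bool" where
  "smooth_manifold M A \<longleftrightarrow>
     Hausdorff_space M \<and> second_countable M \<and> topspace M = (\<Union>c\<in>A. fst c) \<and>
     (\<forall>c\<in>A. openin M (fst c) \<and> open (chart_range c) \<and>
        homeomorphic_map (subtopology M (fst c)) (top_of_set (chart_range c)) (snd c)) \<and>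
     (\<forall>c\<in>A. \<forall>d\<in>A. smooth_on (snd c ` (fst c \<inter> fst d)) (snd d \<circ> chart_inv c))"

definition carrier_of :: "('m, 'a) chart set \<Rightarrow> 'm set" where
  "carrier_of A = (\<Union>c\<in>A. fst c)"

definition chart_at :: "('m, 'a) chart set \<Rightarrow> 'm \<Rightarrow> ('m, 'a) chart" where
  "chart_at A p = (SOME c. c \<in> A \<and> p \<in> fst c)"

text \<open>A tangent vector at \<open>p\<close> is the family of its component vectors in all charts around \<open>p\<close>,
  related by the derivatives of the coordinate changes. The family is set to \<open>0\<close> at the
  other charts, so that equality of tangent vectors is equality of functions and the zero
  vector is \<open>\<lambda>_. 0\<close>.\<close>

type_synonym ('m, 'a) tvec = "('m, 'a) chart \<Rightarrow> 'a"

definition tangent_space ::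
    "('m, 'a::euclidean_space) chart set \<Rightarrow> 'm \<Rightarrow> ('m, 'a) tvec set" where
  "tangent_space A p = {v.
     (\<forall>c. c \<notin> A \<or> p \<notin> fst c \<longrightarrow> v c = 0) \<and>
     (\<forall>c\<in>A. \<forall>d\<in>A. p \<in> fst c \<longrightarrow> p \<in> fst d \<longrightarrow>
        v d = frechet_derivative (snd d \<circ> chart_inv c) (at (snd c p)) (v c))}"

text \<open>The tangent vector at \<open>p\<close> whose components in the chart \<open>c\<close> are \<open>a\<close>.\<close>

definition tvec_of ::
    "('m, 'a::euclidean_space) chart set \<Rightarrow> ('m, 'a) chart \<Rightarrow> 'm \<Rightarrow> 'a \<Rightarrow> ('m, 'a) tvec" where
  "tvec_of A c p a = (\<lambda>d. if d \<in> A \<and> p \<in> fst d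
     then frechet_derivative (snd d \<circ> chart_inv c) (at (snd c p)) a else 0)"

definition smooth_function :: "('m, 'a::euclidean_space) chart set \<Rightarrow> ('m \<Rightarrow> real) \<Rightarrow> bool" where
  "smooth_function A f \<longleftrightarrow> (\<forall>c\<in>A. smooth_on (chart_range c) (f \<circ> chart_inv c))"

definition vec_apply ::
    "('m, 'a::euclidean_space) chart set \<Rightarrow> 'm \<Rightarrow> ('m, 'a) tvec \<Rightarrow> ('m \<Rightarrow> real) \<Rightarrow> real" where
  "vec_apply A p v f =
     (let c = chart_at A p in frechet_derivative (f \<circ> chart_inv c) (at (snd c p)) (v c))"

definition smooth_vector_field ::
    "('m, 'a::euclidean_space) chart set \<Rightarrow> ('m \<Rightarrow> ('m, 'a) tvec) \<Rightarrow> bool" where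
  "smooth_vector_field A X \<longleftrightarrow>
     (\<forall>p\<in>carrier_of A. X p \<in> tangent_space A p) \<and>
     (\<forall>c\<in>A. smooth_on (chart_range c) (\<lambda>x. X (chart_inv c x) c))"

text \<open>In coordinates, \<open>[X,Y]^i = X^j \<partial>Y^i/\<partial>x^j - Y^j \<partial>X^i/\<partial>x^j\<close>.\<close>

definition lie_bracket ::
    "('m, 'a::euclidean_space) chart set \<Rightarrow> ('m \<Rightarrow> ('m, 'a) tvec) \<Rightarrow> ('m \<Rightarrow> ('m, 'a) tvec)
      \<Rightarrow> 'm \<Rightarrow> ('m, 'a) tvec" where
  "lie_bracket A X Y p = (\<lambda>c. if c \<in> A \<and> p \<in> fst c then
       frechet_derivative (\<lambda>x. Y (chart_inv c x) c) (at (snd c p)) (X p c)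
     - frechet_derivative (\<lambda>x. X (chart_inv c x) c) (at (snd c p)) (Y p c) else 0)"

definition torsion ::
    "('m, 'a::euclidean_space) chart set
      \<Rightarrow> ('m \<Rightarrow> ('m, 'a) tvec \<Rightarrow> ('m \<Rightarrow> ('m, 'a) tvec) \<Rightarrow> ('m, 'a) tvec)
      \<Rightarrow> ('m \<Rightarrow> ('m, 'a) tvec) \<Rightarrow> ('m \<Rightarrow> ('m, 'a) tvec) \<Rightarrow> 'm \<Rightarrow> ('m, 'a) tvec" where
  "torsion A nabla X Y p =
     (\<lambda>c. nabla p (X p) Y c - nabla p (Y p) X c - lie_bracket A X Y p c)"

subsection \<open>The tangent bundle and the slit tangent bundle\<close>

type_synonym ('m, 'a) tpoint = "'m \<times> ('m, 'a) tvec"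

definition tangent_bundle :: "('m, 'a::euclidean_space) chart set \<Rightarrow> ('m, 'a) tpoint set" where
  "tangent_bundle A = {(p, v). p \<in> carrier_of A \<and> v \<in> tangent_space A p}"

text \<open>The natural chart \<open>(x^i,y^i)\<close> of the slit tangent bundle induced by a chart \<open>(x^i)\<close> of
  the base. These charts make the slit tangent bundle a manifold, so that its tangent spaces,
  smooth functions and vector fields are instances of the notions above.\<close>

definition slit_chart ::
    "('m, 'a::euclidean_space) chart set \<Rightarrow> ('m, 'a) chart \<Rightarrow> (('m, 'a) tpoint, 'a \<times> 'a) chart" where
  "slit_chart A c = ({(p, v). p \<in> fst c \<and> v \<in> tangent_space A p \<and> v \<noteq> (\<lambda>_. 0)},
     \<lambda>(p, v). (snd c p, v c))"

definition slit_atlas ::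
    "('m, 'a::euclidean_space) chart set \<Rightarrow> (('m, 'a) tpoint, 'a \<times> 'a) chart set" where
  "slit_atlas A = slit_chart A ` A"

type_synonym ('m, 'a) dtvec = "(('m, 'a) tpoint, 'a \<times> 'a) tvec"

subsection \<open>Finsler functions in natural coordinates\<close>

text \<open>Throughout, \<open>L\<close> is the Finsler function in natural coordinates and \<open>u = (x, y)\<close>. Index
  positions follow the order in which the tensors are written: \<open>cartan_up L u i j k\<close> is
  \<open>A^i_{jk}\<close>, \<open>gamma L u i j k\<close> is \<open>\<gamma>^i_{jk}\<close> and \<open>nonlin L u i j\<close> is \<open>N^i_j\<close>.\<close>

type_synonym 'n coord = "(real ^ 'n) \<times> (real ^ 'n)"

definition pdx :: "'n::finite \<Rightarrow> ('n coord \<Rightarrow> real) \<Rightarrow> 'n coord \<Rightarrow> real" where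
  "pdx k f u = frechet_derivative f (at u) (axis k 1, 0)"

definition pdy :: "'n::finite \<Rightarrow> ('n coord \<Rightarrow> real) \<Rightarrow> 'n coord \<Rightarrow> real" where
  "pdy k f u = frechet_derivative f (at u) (0, axis k 1)"

definition fund :: "('n::finite coord \<Rightarrow> real) \<Rightarrow> 'n coord \<Rightarrow> real ^ 'n ^ 'n" where
  "fund L u = (\<chi> i j. 1 / 2 * pdy i (pdy j (\<lambda>w. (L w)\<^sup>2)) u)"

definition fund_inv :: "('n::finite coord \<Rightarrow> real) \<Rightarrow> 'n coord \<Rightarrow> real ^ 'n ^ 'n" where
  "fund_inv L u = matrix_inv (fund L u)"

definition cartan :: "('n::finite coord \<Rightarrow> real) \<Rightarrow> 'n coord \<Rightarrow> 'n \<Rightarrow> 'n \<Rightarrow> 'n \<Rightarrow> real" where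
  "cartan L u i j k = L u / 2 * pdy k (\<lambda>w. fund L w $ i $ j) u"

definition cartan_up :: "('n::finite coord \<Rightarrow> real) \<Rightarrow> 'n coord \<Rightarrow> 'n \<Rightarrow> 'n \<Rightarrow> 'n \<Rightarrow> real" where
  "cartan_up L u i j k = (\<Sum>l\<in>UNIV. fund_inv L u $ i $ l * cartan L u l j k)"

definition gamma :: "('n::finite coord \<Rightarrow> real) \<Rightarrow> 'n coord \<Rightarrow> 'n \<Rightarrow> 'n \<Rightarrow> 'n \<Rightarrow> real" where
  "gamma L u i j k = 1 / 2 * (\<Sum>s\<in>UNIV. fund_inv L u $ i $ s *
     (pdx k (\<lambda>w. fund L w $ s $ j) u - pdx s (\<lambda>w. fund L w $ j $ k) u
      + pdx j (\<lambda>w. fund L w $ s $ k) u))"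

definition nonlin :: "('n::finite coord \<Rightarrow> real) \<Rightarrow> 'n coord \<Rightarrow> 'n \<Rightarrow> 'n \<Rightarrow> real" where
  "nonlin L u i j = L u *
     ((\<Sum>k\<in>UNIV. gamma L u i j k * (snd u $ k / L u))
      - (\<Sum>k\<in>UNIV. \<Sum>r\<in>UNIV. \<Sum>s\<in>UNIV.
           cartan_up L u i j k * gamma L u k r s * (snd u $ r / L u) * (snd u $ s / L u)))"

text \<open>The 1-forms \<open>\<delta>y^i = dy^i + N^i_j dx^j\<close>, collected in a vector-valued form, evaluated at
  the tangent vector \<open>z\<close> of the slit tangent bundle with natural components
  \<open>(dx(z), dy(z)) = (fst z, snd z)\<close>.\<close>

definition delta_y :: "('n::finite coord \<Rightarrow> real) \<Rightarrow> 'n coord \<Rightarrow> 'n coord \<Rightarrow> real ^ 'n" where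
  "delta_y L u z = (\<chi> i. snd z $ i + (\<Sum>j\<in>UNIV. nonlin L u i j * fst z $ j))"

subsection \<open>Finsler spaces\<close>

text \<open>The Finsler function in the natural coordinates induced by the chart \<open>c\<close>.\<close>

definition finsler_coord ::
    "('m, real ^ 'n::finite) chart set \<Rightarrow> (('m, real ^ 'n) tpoint \<Rightarrow> real)
      \<Rightarrow> ('m, real ^ 'n) chart \<Rightarrow> 'n coord \<Rightarrow> real" where
  "finsler_coord A F c = F \<circ> chart_inv (slit_chart A c)"

definition finsler_space ::
    "'m topology \<Rightarrow> ('m, real ^ 'n::finite) chart set \<Rightarrow> (('m, real ^ 'n) tpoint \<Rightarrow> real) \<Rightarrow> bool" where
  "finsler_space M A F \<longleftrightarrow>
     smooth_manifold M A \<and>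
     (\<forall>u\<in>tangent_bundle A. F u \<ge> 0) \<and>
     smooth_function (slit_atlas A) F \<and>
     (\<forall>(p, v)\<in>tangent_bundle A. \<forall>r\<ge>0. F (p, \<lambda>c. r *\<^sub>R v c) = r * F (p, v)) \<and>
     (\<forall>c\<in>A. \<forall>u\<in>chart_range (slit_chart A c). \<forall>a. a \<noteq> 0 \<longrightarrow>
        a \<bullet> (fund (finsler_coord A F c) u *v a) > 0)"

text \<open>The horizontal lift \<open>X^i \<delta>/\<delta>x^i = X^i (\<partial>/\<partial>x^i - N^j_i \<partial>/\<partial>y^j)\<close> at \<open>u\<close>, computed in some
  chart around the base point of \<open>u\<close>; it does not depend on that chart.\<close>

definition horizontal_lift ::
    "('m, real ^ 'n::finite) chart set \<Rightarrow> (('m, real ^ 'n) tpoint \<Rightarrow> real)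
      \<Rightarrow> ('m, real ^ 'n) tpoint \<Rightarrow> ('m, real ^ 'n) tvec \<Rightarrow> ('m, real ^ 'n) dtvec" where
  "horizontal_lift A F u X =
     (let c = chart_at A (fst u); e = slit_chart A c; L = finsler_coord A F c in
      tvec_of (slit_atlas A) e u
        (X c, \<chi> j. - (\<Sum>i\<in>UNIV. nonlin L (snd e u) j i * X c $ i)))"

subsection \<open>Linear connections on the pull-back bundle\<close>

text \<open>The fibre of the pull-back bundle over \<open>u\<close> is identified with the tangent space of the
  base at \<open>fst u\<close>; so the pull-back of a vector field \<open>Y\<close> is the section \<open>\<lambda>u. Y (fst u)\<close>.\<close>

type_synonym ('m, 'a) pbsection = "('m, 'a) tpoint \<Rightarrow> ('m, 'a) tvec"

definition smooth_section ::
    "('m, 'a::euclidean_space) chart set \<Rightarrow> ('m, 'a) pbsection \<Rightarrow> bool" where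
  "smooth_section A S \<longleftrightarrow>
     (\<forall>u\<in>carrier_of (slit_atlas A). S u \<in> tangent_space A (fst u)) \<and>
     (\<forall>c\<in>A. smooth_on (chart_range (slit_chart A c)) (\<lambda>w. S (chart_inv (slit_chart A c) w) c))"

text \<open>\<open>D u z S\<close> is the covariant derivative at \<open>u\<close> of the section \<open>S\<close> in the direction of the
  tangent vector \<open>z\<close> of the slit tangent bundle.\<close>

type_synonym ('m, 'a) pbconn =
  "('m, 'a) tpoint \<Rightarrow> ('m, 'a) dtvec \<Rightarrow> ('m, 'a) pbsection \<Rightarrow> ('m, 'a) tvec"

definition linear_connection ::
    "('m, 'a::euclidean_space) chart set \<Rightarrow> ('m, 'a) pbconn \<Rightarrow> bool" where
  "linear_connection A D \<longleftrightarrow>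
     (\<forall>S. smooth_section A S \<longrightarrow>
        (\<forall>u\<in>carrier_of (slit_atlas A). \<forall>z\<in>tangent_space (slit_atlas A) u.
           D u z S \<in> tangent_space A (fst u) \<and>
           (\<forall>z'\<in>tangent_space (slit_atlas A) u. \<forall>a b.
              D u (\<lambda>e. a *\<^sub>R z e + b *\<^sub>R z' e) S
                = (\<lambda>c. a *\<^sub>R D u z S c + b *\<^sub>R D u z' S c)) \<and>
           (\<forall>S'. smooth_section A S' \<longrightarrow>
              D u z (\<lambda>w c. S w c + S' w c) = (\<lambda>c. D u z S c + D u z S' c)) \<and>
           (\<forall>f. smooth_function (slit_atlas A) f \<longrightarrow>
              D u z (\<lambda>w c. f w *\<^sub>R S w c)
                = (\<lambda>c. vec_apply (slit_atlas A) u z f *\<^sub>R S u c + f u *\<^sub>R D u z S c))) \<and>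
        (\<forall>Z. smooth_vector_field (slit_atlas A) Z \<longrightarrow>
           smooth_section A (\<lambda>u. D u (Z u) S)))"

text \<open>Differential 1-forms on the domain of a natural chart, written in that chart:
  \<open>\<alpha> w z\<close> is the value at the point \<open>w\<close> on the tangent vector with components \<open>z\<close>.\<close>

type_synonym 'e form1 = "'e \<Rightarrow> 'e \<Rightarrow> real"

definition smooth_form1 :: "'e::euclidean_space set \<Rightarrow> 'e form1 \<Rightarrow> bool" where
  "smooth_form1 V \<alpha> \<longleftrightarrow> (\<forall>w\<in>V. linear (\<alpha> w)) \<and> (\<forall>z. smooth_on V (\<lambda>w. \<alpha> w z))"

definition ext_deriv :: "'e::euclidean_space form1 \<Rightarrow> 'e \<Rightarrow> 'e \<Rightarrow> 'e \<Rightarrow> real" where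
  "ext_deriv \<alpha> w z z' = frechet_derivative (\<lambda>w. \<alpha> w z') (at w) z
                      - frechet_derivative (\<lambda>w. \<alpha> w z) (at w) z'"

definition wedge :: "'e form1 \<Rightarrow> 'e form1 \<Rightarrow> 'e \<Rightarrow> 'e \<Rightarrow> 'e \<Rightarrow> real" where
  "wedge \<alpha> \<beta> w z z' = \<alpha> w z * \<beta> w z' - \<alpha> w z' * \<beta> w z"

definition dx :: "'n::finite \<Rightarrow> 'n coord form1" where
  "dx i w z = fst z $ i"

text \<open>\<open>\<omega> i j\<close> is the connection form \<open>\<omega>^i_j\<close> of \<open>D\<close> with respect to the local frame of the
  pull-backs of \<open>\<partial>/\<partial>x^i\<close>, i.e. \<open>(D_z S)^i = dS^i(z) + \<omega>^i_j(z) S^j\<close>.\<close>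

definition connection_forms ::
    "('m, real ^ 'n::finite) chart set \<Rightarrow> ('m, real ^ 'n) pbconn \<Rightarrow> ('m, real ^ 'n) chart
      \<Rightarrow> ('n \<Rightarrow> 'n \<Rightarrow> 'n coord form1) \<Rightarrow> bool" where
  "connection_forms A D c \<omega> \<longleftrightarrow> (let e = slit_chart A c in
     (\<forall>i j. smooth_form1 (chart_range e) (\<omega> i j)) \<and>
     (\<forall>S. smooth_section A S \<longrightarrow> (\<forall>u\<in>fst e. \<forall>z\<in>tangent_space (slit_atlas A) u. \<forall>i.
        D u z S c $ i =
          frechet_derivative (\<lambda>w. S (chart_inv e w) c $ i) (at (snd e u)) (z e)
          + (\<Sum>j\<in>UNIV. \<omega> i j (snd e u) (z e) * S u c $ j))))"

definition chern_rund_connection ::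
    "('m, real ^ 'n::finite) chart set \<Rightarrow> (('m, real ^ 'n) tpoint \<Rightarrow> real)
      \<Rightarrow> ('m, real ^ 'n) pbconn \<Rightarrow> bool" where
  "chern_rund_connection A F D \<longleftrightarrow> linear_connection A D \<and>
     (\<forall>c\<in>A. let L = finsler_coord A F c in
       \<exists>\<omega>. connection_forms A D c \<omega> \<and>
         (\<forall>w\<in>chart_range (slit_chart A c).
           (\<forall>i z z'. ext_deriv (dx i) w z z' - (\<Sum>j\<in>UNIV. wedge (dx j) (\<omega> i j) w z z') = 0) \<and>
           (\<forall>i j z.
              frechet_derivative (\<lambda>w. fund L w $ i $ j) (at w) z
              - (\<Sum>k\<in>UNIV. fund L w $ k $ j * \<omega> k i w z)
              - (\<Sum>k\<in>UNIV. fund L w $ i $ k * \<omega> k j w z)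
              = 2 * (\<Sum>k\<in>UNIV. cartan L w i j k * (delta_y L w z $ k / L w)))))"

subsection \<open>Integration over the indicatrix and the average connection\<close>

definition indicatrix ::
    "('m, real ^ 'n::finite) chart set \<Rightarrow> (('m, real ^ 'n) tpoint \<Rightarrow> real)
      \<Rightarrow> 'm \<Rightarrow> ('m, real ^ 'n) tvec set" where
  "indicatrix A F p = {v \<in> tangent_space A p. F (p, v) = 1}"

text \<open>The contraction of \<open>sqrt (det g) \<delta>y^1/F \<and> \<dots> \<and> \<delta>y^n/F\<close> with \<open>l = y^i/F \<partial>/\<partial>y^i\<close>, evaluated
  at the \<open>n - 1\<close> vertical vectors \<open>(0, W i)\<close> with \<open>i \<noteq> k\<close>. The wedge product is the determinant
  of its arguments; since the index type is not ordered, \<open>l\<close> is put in slot \<open>k\<close> instead of the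
  first one, which affects only the sign.\<close>

definition indicatrix_form ::
    "('n::finite coord \<Rightarrow> real) \<Rightarrow> 'n coord \<Rightarrow> 'n \<Rightarrow> ('n \<Rightarrow> real ^ 'n) \<Rightarrow> real" where
  "indicatrix_form L u k W = sqrt (det (fund L u)) *
     det ((\<chi> i. (1 / L u) *\<^sub>R delta_y L u
        (if i = k then (0, (1 / L u) *\<^sub>R snd u) else (0, W i))) :: real ^ 'n ^ 'n)"

text \<open>The integral of \<open>f\<close> over the indicatrix against this volume form is computed from a
  parametrization. In the coordinates of a chart around \<open>p\<close>, the radial projection
  \<open>\<psi> y = y / F y\<close> maps the boundary of the cube \<open>[-1,1]^n\<close> homeomorphically onto the indicatrix,
  and each of the \<open>2 n\<close> faces \<open>y_k = \<sigma>\<close> (with \<open>\<sigma> = 1\<close> or \<open>\<sigma> = -1\<close>) diffeomorphically onto its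
  image; the images overlap in null sets only (that they cover the indicatrix is lemma
  \<open>indicatrix_radial\<close> below). On a face, parametrized by the coordinates
  \<open>y_i\<close> with \<open>i \<noteq> k\<close>, the pull-back of the form is its value at the partial derivatives of \<open>\<psi>\<close>.
  The form vanishes nowhere on the indicatrix because \<open>l\<close> is transversal to it, and the
  indicatrix is oriented so that the form is positive, whence the absolute value. The integral
  depends neither on the chart nor on the choice of the parametrization.\<close>

definition indicatrix_integral ::
    "('m, real ^ 'n::finite) chart set \<Rightarrow> (('m, real ^ 'n) tpoint \<Rightarrow> real)
      \<Rightarrow> 'm \<Rightarrow> (('m, real ^ 'n) tvec \<Rightarrow> 'b::{banach, second_countable_topology}) \<Rightarrow> 'b" where
  "indicatrix_integral A F p f =
     (let c = chart_at A p; x = snd c p; L = finsler_coord A F c;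
          \<psi> = (\<lambda>y. (1 / L (x, y)) *\<^sub>R y) in
      \<Sum>\<sigma>\<in>{-1, 1}. \<Sum>k\<in>UNIV.
        LINT s : (UNIV - {k} \<rightarrow>\<^sub>E {-1..1}) | (\<Pi>\<^sub>M i\<in>UNIV - {k}. lborel).
          (let y = (\<chi> i. if i = k then \<sigma> else s i) in
           \<bar>indicatrix_form L (x, \<psi> y) k (\<lambda>i. frechet_derivative \<psi> (at y) (axis i 1))\<bar>
             *\<^sub>R f (tvec_of A c p (\<psi> y))))"

definition indicatrix_vol ::
    "('m, real ^ 'n::finite) chart set \<Rightarrow> (('m, real ^ 'n) tpoint \<Rightarrow> real) \<Rightarrow> 'm \<Rightarrow> real" where
  "indicatrix_vol A F p = indicatrix_integral A F p (\<lambda>v. 1)"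

definition indicatrix_average ::
    "('m, real ^ 'n::finite) chart set \<Rightarrow> (('m, real ^ 'n) tpoint \<Rightarrow> real)
      \<Rightarrow> 'm \<Rightarrow> (('m, real ^ 'n) tvec \<Rightarrow> 'b::{banach, second_countable_topology}) \<Rightarrow> 'b" where
  "indicatrix_average A F p f = (1 / indicatrix_vol A F p) *\<^sub>R indicatrix_integral A F p f"

text \<open>The average of a function on the indicatrix at \<open>p\<close> with values in the tangent space at
  \<open>p\<close> is taken componentwise in every chart.\<close>

definition average_connection ::
    "('m, real ^ 'n::finite) chart set \<Rightarrow> (('m, real ^ 'n) tpoint \<Rightarrow> real)
      \<Rightarrow> ('m, real ^ 'n) pbconn
      \<Rightarrow> 'm \<Rightarrow> ('m, real ^ 'n) tvec \<Rightarrow> ('m \<Rightarrow> ('m, real ^ 'n) tvec) \<Rightarrow> ('m, real ^ 'n) tvec" where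
  "average_connection A F D p X Y = (\<lambda>c. indicatrix_average A F p
     (\<lambda>v. D (p, v) (horizontal_lift A F (p, v) X) (\<lambda>u. Y (fst u)) c))"

subsection \<open>The radial parametrization covers exactly the indicatrix\<close>

lemma chart_inv_coord:
  assumes "smooth_manifold M A" "c \<in> A" "p \<in> fst c"
  shows "chart_inv c (snd c p) = p"
proof -
  have "homeomorphic_map (subtopology M (fst c)) (top_of_set (chart_range c)) (snd c)"
    and "openin M (fst c)"
    using assms unfolding smooth_manifold_def by auto
  then have "inj_on (snd c) (fst c)"
    by (metis homeomorphic_imp_injective_map openin_subset topspace_subtopology_subset)
  then show ?thesis using assms(3) by (simp add: chart_inv_def)
qed

lemma transition_domain_open:
  assumes "smooth_manifold M A" "c \<in> A" "d \<in> A"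
  shows "open (snd c ` (fst c \<inter> fst d))"
proof -
  have h: "homeomorphic_map (subtopology M (fst c)) (top_of_set (chart_range c)) (snd c)"
    and o: "openin M (fst c)" "openin M (fst d)" "open (chart_range c)"
    using assms unfolding smooth_manifold_def by auto
  have "openin (subtopology M (fst c)) (fst c \<inter> fst d)"
    using o by (meson openin_Int openin_subtopology_Int2)
  then have "openin (top_of_set (chart_range c)) (snd c ` (fst c \<inter> fst d))"
    using homeomorphic_imp_open_map[OF h] by (auto simp: open_map_def)
  then show ?thesis using o(3) openin_open_trans by blast
qed

lemma transition_has_derivative:
  assumes "smooth_manifold M A" "c \<in> A" "d \<in> A" "p \<in> fst c" "p \<in> fst d"
  shows "((snd d \<circ> chart_inv c) has_derivative
           frechet_derivative (snd d \<circ> chart_inv c) (at (snd c p))) (at (snd c p))"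
proof -
  have "Ck_on (Suc 0) (snd c ` (fst c \<inter> fst d)) (snd d \<circ> chart_inv c)"
    using assms unfolding smooth_manifold_def smooth_on_def by blast
  then have "(snd d \<circ> chart_inv c) differentiable (at (snd c p))"
    using transition_domain_open[OF assms(1-3)] assms(4,5)
    by (simp add: differentiable_on_eq_differentiable_at)
  then show ?thesis by (simp add: frechet_derivative_works)
qed

lemma tvec_of_chart:
  assumes "smooth_manifold M A" "c \<in> A" "p \<in> fst c"
  shows "tvec_of A c p a c = a"
proof -
  have "((snd c \<circ> chart_inv c) has_derivative (\<lambda>x. x)) (at (snd c p))"
  proof (rule has_derivative_transform_within_open)
    show "((\<lambda>x. x) has_derivative (\<lambda>x. x)) (at (snd c p))" by (rule has_derivative_ident)
    show "open (snd c ` (fst c \<inter> fst c))" by (rule transition_domain_open[OF assms(1,2,2)])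
  qed (use assms chart_inv_coord[OF assms(1,2)] in auto)
  then show ?thesis using assms by (simp add: tvec_of_def flip: frechet_derivative_at)
qed

lemma tvec_of_in_tangent_space:
  assumes M: "smooth_manifold M A" and c: "c \<in> A" and p: "p \<in> fst c"
  shows "tvec_of A c p a \<in> tangent_space A p"
proof -
  have "frechet_derivative (snd e \<circ> chart_inv c) (at (snd c p)) a =
        frechet_derivative (snd e \<circ> chart_inv d) (at (snd d p))
          (frechet_derivative (snd d \<circ> chart_inv c) (at (snd c p)) a)"
    if "d \<in> A" "p \<in> fst d" "e \<in> A" "p \<in> fst e" for d e
  proof -
    let ?f = "snd d \<circ> chart_inv c" and ?g = "snd e \<circ> chart_inv d"
    have eq: "?f (snd c p) = snd d p" using chart_inv_coord[OF M c p] by simp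
    have "((?g \<circ> ?f) has_derivative
        (frechet_derivative ?g (at (snd d p)) \<circ> frechet_derivative ?f (at (snd c p)))) (at (snd c p))"
      using transition_has_derivative[OF M c that(1) p that(2)]
        transition_has_derivative[OF M that(1,3,2,4)]
      by (intro diff_chain_at) (simp_all only: eq)
    then have "((snd e \<circ> chart_inv c) has_derivative
        (frechet_derivative ?g (at (snd d p)) \<circ> frechet_derivative ?f (at (snd c p)))) (at (snd c p))"
    proof (rule has_derivative_transform_within_open)
      show "open (snd c ` (fst c \<inter> fst d))" by (rule transition_domain_open[OF M c that(1)])
    qed (use p that chart_inv_coord[OF M c] chart_inv_coord[OF M that(1)] in auto)
    then show ?thesis by (simp flip: frechet_derivative_at)
  qed
  note key = this
  have v: "tvec_of A c p a d = frechet_derivative (snd d \<circ> chart_inv c) (at (snd c p)) a"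
    if "d \<in> A" "p \<in> fst d" for d using that by (simp add: tvec_of_def)
  show ?thesis
    unfolding tangent_space_def
  proof (intro CollectI conjI allI ballI impI)
    fix d e assume de: "d \<in> A" "e \<in> A" "p \<in> fst d" "p \<in> fst e"
    show "tvec_of A c p a e =
        frechet_derivative (snd e \<circ> chart_inv d) (at (snd d p)) (tvec_of A c p a d)"
      unfolding v[OF de(1,3)] v[OF de(2,4)] by (rule key[OF de(1,3,2,4)])
  qed (auto simp: tvec_of_def)
qed

lemma tvec_of_components:
  assumes "c \<in> A" "p \<in> fst c" "v \<in> tangent_space A p"
  shows "tvec_of A c p (v c) = v"
proof
  fix d
  show "tvec_of A c p (v c) d = v d"
  proof (cases "d \<in> A \<and> p \<in> fst d")
    case True
    then have "v d = frechet_derivative (snd d \<circ> chart_inv c) (at (snd c p)) (v c)"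
      using assms unfolding tangent_space_def by blast
    with True show ?thesis by (simp only: tvec_of_def if_True simp_thms)
  next
    case False
    then have "v d = 0" using assms(3) unfolding tangent_space_def by blast
    with False show ?thesis unfolding tvec_of_def by (simp only: if_False)
  qed
qed

lemma tvec_of_scale:
  assumes "smooth_manifold M A" "c \<in> A" "p \<in> fst c"
  shows "tvec_of A c p (r *\<^sub>R a) = (\<lambda>d. r *\<^sub>R tvec_of A c p a d)"
proof -
  have "linear (frechet_derivative (snd d \<circ> chart_inv c) (at (snd c p)))"
    if "d \<in> A" "p \<in> fst d" for d
    using transition_has_derivative[OF assms(1,2) that(1) assms(3) that(2)] has_derivative_linear
    by blast
  then show ?thesis by (auto simp: tvec_of_def fun_eq_iff linear_scale)
qed

lemma slit_chart_inv:
  assumes M: "smooth_manifold M A" and c: "c \<in> A" and p: "p \<in> fst c" and a: "a \<noteq> 0"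
  shows "chart_inv (slit_chart A c) (snd c p, a) = (p, tvec_of A c p a)"
    and "(snd c p, a) \<in> chart_range (slit_chart A c)"
    and "(p, tvec_of A c p a) \<in> fst (slit_chart A c)"
proof -
  have inj: "inj_on (snd (slit_chart A c)) (fst (slit_chart A c))"
  proof (clarsimp simp: inj_on_def slit_chart_def)
    fix q v q' v'
    assume *: "q \<in> fst c" "v \<in> tangent_space A q" "q' \<in> fst c" "v' \<in> tangent_space A q'"
      "snd c q = snd c q'" "v c = v' c"
    then have "q = q'" by (metis chart_inv_coord[OF M c])
    with * show "q = q' \<and> v = v'" by (metis tvec_of_components[OF c])
  qed
  have "tvec_of A c p a \<noteq> (\<lambda>_. 0)"
    using tvec_of_chart[OF M c p, of a] a by auto
  then show mem: "(p, tvec_of A c p a) \<in> fst (slit_chart A c)"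
    using p tvec_of_in_tangent_space[OF M c p, of a] by (simp add: slit_chart_def)
  have im: "snd (slit_chart A c) (p, tvec_of A c p a) = (snd c p, a)"
    using tvec_of_chart[OF M c p, of a] by (simp add: slit_chart_def)
  show "chart_inv (slit_chart A c) (snd c p, a) = (p, tvec_of A c p a)"
    using inv_into_f_f[OF inj mem] by (simp add: chart_inv_def im)
  show "(snd c p, a) \<in> chart_range (slit_chart A c)"
    using mem im by (metis chart_range_def image_eqI)
qed

lemma slit_chart_range:
  assumes M: "smooth_manifold M A" and c: "c \<in> A"
  shows "chart_range (slit_chart A c) = chart_range c \<times> (UNIV - {0})"
proof -
  have "v c \<noteq> 0" if "p \<in> fst c" "v \<in> tangent_space A p" "v \<noteq> (\<lambda>_. 0)" for p v
  proof
    assume "v c = 0"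
    then have "v = (\<lambda>d. 0 *\<^sub>R tvec_of A c p 0 d)"
      using tvec_of_components[OF c that(1,2)] tvec_of_scale[OF M c that(1), of 0 0] by simp
    with that show False by simp
  qed
  then have "chart_range (slit_chart A c) \<subseteq> chart_range c \<times> (UNIV - {0})"
    by (auto simp: chart_range_def slit_chart_def)
  moreover have "chart_range c \<times> (UNIV - {0}) \<subseteq> chart_range (slit_chart A c)"
    using slit_chart_inv(2)[OF M c] by (auto simp: chart_range_def[of c])
  ultimately show ?thesis by blast
qed

context
  fixes M :: "'m topology" and A :: "('m, real ^ 'n::finite) chart set" and F c p
  assumes fin: "finsler_space M A F" and c: "c \<in> A" and p: "p \<in> fst c"
begin

lemma finsler_manifold: "smooth_manifold M A" using fin by (simp add: finsler_space_def)

lemma finsler_coord_eq: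
  "a \<noteq> 0 \<Longrightarrow> finsler_coord A F c (snd c p, a) = F (p, tvec_of A c p a)"
  using slit_chart_inv(1)[OF finsler_manifold c p] by (simp add: finsler_coord_def)

lemma F_scale:
  assumes "r \<ge> 0" shows "F (p, tvec_of A c p (r *\<^sub>R a)) = r * F (p, tvec_of A c p a)"
proof -
  have "(p, tvec_of A c p a) \<in> tangent_bundle A"
    using c p tvec_of_in_tangent_space[OF finsler_manifold c p] by (auto simp: tangent_bundle_def carrier_of_def)
  then show ?thesis
    using fin assms tvec_of_scale[OF finsler_manifold c p] unfolding finsler_space_def by auto
qed

lemma finsler_coord_pos:
  assumes a: "a \<noteq> 0"
  shows "finsler_coord A F c (snd c p, a) > 0"
proof -
  define L where "L = finsler_coord A F c"
  define x where "x = snd c p"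
  define V where "V = chart_range (slit_chart A c)"
  define G where "G = (\<lambda>w. (L w)\<^sup>2)"
  have V: "V = chart_range c \<times> (UNIV - {0})"
    unfolding V_def by (rule slit_chart_range[OF finsler_manifold c])
  have "open (chart_range c)" using finsler_manifold c unfolding smooth_manifold_def by auto
  then have oV: "open V" unfolding V by (intro open_Times) auto
  have xV: "(x, b) \<in> V" if "b \<noteq> 0" for b
    unfolding x_def V_def by (rule slit_chart_inv(2)[OF finsler_manifold c p that])
  have "smooth_on V L"
    using fin c unfolding finsler_space_def smooth_function_def slit_atlas_def V_def L_def
      finsler_coord_def by auto
  then have C2: "Ck_on (Suc (Suc 0)) V L" unfolding smooth_on_def by blast
  have dL: "(L has_derivative frechet_derivative L (at w)) (at w)" if "w \<in> V" for w
    using C2 oV that by (simp add: differentiable_on_eq_differentiable_at frechet_derivative_works)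
  have ddL: "(\<lambda>w. frechet_derivative L (at w) v) differentiable (at w)" if "w \<in> V" for w v
    using C2 oV that by (cases v) (simp add: differentiable_on_eq_differentiable_at)
  have dG: "(G has_derivative (\<lambda>v. 2 * L w * frechet_derivative L (at w) v)) (at w)"
    if "w \<in> V" for w
    unfolding G_def by (auto intro!: derivative_eq_intros dL[OF that] simp: ac_simps)
  then have G': "frechet_derivative G (at w) v = 2 * L w * frechet_derivative L (at w) v"
    if "w \<in> V" for w v
    using frechet_derivative_at[OF dG[OF that]] by metis
  have linG: "linear (frechet_derivative G (at w))" if "w \<in> V" for w
    using dG[OF that] frechet_derivative_at has_derivative_linear by metis
  have dpd: "((pdy j G) has_derivative frechet_derivative (pdy j G) (at w)) (at w)" if "w \<in> V" for j w
  proof -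
    have "(\<lambda>w. 2 * L w * frechet_derivative L (at w) (0, axis j 1)) differentiable (at w)"
      using ddL[OF that] dL[OF that] by (intro differentiable_mult differentiable_const) (auto simp: differentiable_def)
    then obtain h where
      "((\<lambda>w. 2 * L w * frechet_derivative L (at w) (0, axis j 1)) has_derivative h) (at w)"
      unfolding differentiable_def by blast
    then have "(pdy j G has_derivative h) (at w)"
      by (rule has_derivative_transform_within_open[OF _ oV that]) (simp add: G' pdy_def)
    then have "(pdy j G) differentiable (at w)" unfolding differentiable_def by blast
    then show ?thesis by (simp add: frechet_derivative_works)
  qed
  have Gs: "G (x, t *\<^sub>R a) = t\<^sup>2 * G (x, a)" if "t > 0" for t
    using that a F_scale[of t a] finsler_coord_eq
    by (simp add: G_def L_def x_def power_mult_distrib)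
  have expand: "h (0, a) = (\<Sum>j\<in>UNIV. a $ j * h (0, axis j 1))"
    if "linear h" for h :: "'n coord \<Rightarrow> real"
  proof -
    have l2: "linear (\<lambda>b. h (0, b))"
      using linear_compose[of "\<lambda>b. (0, b)" h] that
      by (simp add: o_def linear_iff)
    have "h (0, a) = h (0, \<Sum>j\<in>UNIV. a $ j *\<^sub>R axis j 1)"
      by (simp add: basis_expansion flip: scalar_mult_eq_scaleR)
    also have "\<dots> = (\<Sum>j\<in>UNIV. h (0, a $ j *\<^sub>R axis j 1))" using linear_sum[OF l2] by simp
    also have "\<dots> = (\<Sum>j\<in>UNIV. a $ j * h (0, axis j 1))" using linear_scale[OF l2] by simp
    finally show ?thesis .
  qed
  have ray: "((\<lambda>t. (x, t *\<^sub>R a)) has_derivative (\<lambda>s. s *\<^sub>R (0, a))) (at t)" for t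
    by (auto intro!: derivative_eq_intros)
  have E1: "(\<Sum>j\<in>UNIV. a $ j * pdy j G (x, t *\<^sub>R a)) = 2 * t * G (x, a)" if t: "t > 0" for t
  proof -
    have w: "(x, t *\<^sub>R a) \<in> V" using xV a t by simp
    have "((\<lambda>s. G (x, s *\<^sub>R a)) has_derivative (\<lambda>s. frechet_derivative G (at (x, t *\<^sub>R a)) (s *\<^sub>R (0, a)))) (at t)"
      using diff_chain_at[OF ray, of G] dG[OF w] frechet_derivative_at[OF dG[OF w]]
      by (simp add: o_def)
    moreover have "((\<lambda>s. G (x, s *\<^sub>R a)) has_derivative (\<lambda>s. s * (2 * t * G (x, a)))) (at t)"
    proof (rule has_derivative_transform_within_open)
      show "((\<lambda>s. s\<^sup>2 * G (x, a)) has_derivative (\<lambda>s. s * (2 * t * G (x, a)))) (at t)"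
        by (auto intro!: derivative_eq_intros)
      show "open {0::real<..}" "t \<in> {0<..}" using t by auto
    qed (use Gs in auto)
    ultimately have "frechet_derivative G (at (x, t *\<^sub>R a)) (1 *\<^sub>R (0, a)) = 1 * (2 * t * G (x, a))"
      using has_derivative_unique by metis
    then show ?thesis using expand[OF linG[OF w]] by (simp add: pdy_def)
  qed
  have w: "(x, 1 *\<^sub>R a) \<in> V" using xV a by simp
  have "((\<lambda>t. \<Sum>j\<in>UNIV. a $ j * pdy j G (x, t *\<^sub>R a)) has_derivative
      (\<lambda>s. \<Sum>j\<in>UNIV. a $ j * frechet_derivative (pdy j G) (at (x, 1 *\<^sub>R a)) (s *\<^sub>R (0, a)))) (at 1)"
    using diff_chain_at[OF ray dpd[OF w]]
    by (intro has_derivative_sum has_derivative_mult_right) (simp add: o_def)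
  moreover have "((\<lambda>t. \<Sum>j\<in>UNIV. a $ j * pdy j G (x, t *\<^sub>R a)) has_derivative
      (\<lambda>s. s * (2 * G (x, a)))) (at 1)"
  proof (rule has_derivative_transform_within_open)
    show "((\<lambda>s. 2 * s * G (x, a)) has_derivative (\<lambda>s. s * (2 * G (x, a)))) (at 1)"
      by (auto intro!: derivative_eq_intros)
    show "open {0::real<..}" "1 \<in> {0::real<..}" by auto
  qed (use E1 in auto)
  ultimately have "(\<lambda>s. \<Sum>j\<in>UNIV. a $ j * frechet_derivative (pdy j G) (at (x, 1 *\<^sub>R a)) (s *\<^sub>R (0, a)))
      = (\<lambda>s. s * (2 * G (x, a)))"
    by (rule has_derivative_unique)
  from fun_cong[OF this, of 1]
  have "(\<Sum>j\<in>UNIV. a $ j * frechet_derivative (pdy j G) (at (x, a)) (0, a)) = 2 * G (x, a)"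
    by simp
  then have "(\<Sum>j\<in>UNIV. a $ j * (\<Sum>i\<in>UNIV. a $ i * pdy i (pdy j G) (x, a))) = 2 * G (x, a)"
    unfolding expand[OF has_derivative_linear[OF dpd[OF xV[OF a]]]] by (simp only: pdy_def)
  moreover have "2 * (a \<bullet> (fund L (x, a) *v a))
      = (\<Sum>i\<in>UNIV. \<Sum>j\<in>UNIV. a $ i * a $ j * pdy i (pdy j G) (x, a))"
    by (simp add: fund_def G_def inner_vec_def matrix_vector_mult_def sum_distrib_left ac_simps)
  moreover have "\<dots> = (\<Sum>j\<in>UNIV. a $ j * (\<Sum>i\<in>UNIV. a $ i * pdy i (pdy j G) (x, a)))"
    by (subst sum.swap) (simp add: sum_distrib_left ac_simps)
  moreover have "a \<bullet> (fund L (x, a) *v a) > 0"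
    using fin c a xV[OF a] unfolding finsler_space_def L_def V_def by auto
  ultimately have "G (x, a) > 0" by simp
  then have "L (x, a) \<noteq> 0" by (auto simp: G_def)
  moreover have "L (x, a) \<ge> 0"
  proof -
    have "(p, tvec_of A c p a) \<in> tangent_bundle A"
      using c p tvec_of_in_tangent_space[OF finsler_manifold c p] by (auto simp: tangent_bundle_def carrier_of_def)
    then show ?thesis using fin a finsler_coord_eq unfolding finsler_space_def L_def x_def by auto
  qed
  ultimately show ?thesis by (simp add: L_def x_def)
qed

lemma indicatrix_radial:
  "indicatrix A F p =
     (\<lambda>y. tvec_of A c p ((1 / finsler_coord A F c (snd c p, y)) *\<^sub>R y)) `
       (\<Union>\<sigma>\<in>{-1, 1}. \<Union>k\<in>UNIV. (\<lambda>s. \<chi> i. if i = k then \<sigma> else s i) ` (UNIV - {k} \<rightarrow>\<^sub>E {-1..1}))"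
  (is "_ = ?\<rho> ` ?Q")
proof (intro subset_antisym subsetI)
  fix v assume "v \<in> ?\<rho> ` ?Q"
  then obtain y where y: "y \<in> ?Q" "v = ?\<rho> y" by blast
  then have "y \<noteq> 0" by (auto simp: vec_eq_iff)
  from finsler_coord_pos[OF this] have "F (p, v) = 1"
    using y F_scale finsler_coord_eq[OF \<open>y \<noteq> 0\<close>] by simp
  then show "v \<in> indicatrix A F p"
    using y tvec_of_in_tangent_space[OF finsler_manifold c p] by (simp add: indicatrix_def)
next
  fix v assume "v \<in> indicatrix A F p"
  then have v: "tvec_of A c p (v c) = v" "F (p, v) = 1"
    using tvec_of_components[OF c p] by (auto simp: indicatrix_def)
  have a: "v c \<noteq> 0"
    using v F_scale[of 0 0] by auto
  define m where "m = Max (range (\<lambda>i. \<bar>v c $ i\<bar>))"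
  have "m \<in> range (\<lambda>i. \<bar>v c $ i\<bar>)" unfolding m_def by (intro Max_in) auto
  then obtain k where k: "m = \<bar>v c $ k\<bar>" by auto
  have le: "\<bar>v c $ i\<bar> \<le> m" for i unfolding m_def by (intro Max_ge) auto
  have m: "m > 0"
  proof -
    obtain i where "v c $ i \<noteq> 0" using a by (auto simp: vec_eq_iff)
    then show ?thesis using le[of i] by linarith
  qed
  define y where "y = (1 / m) *\<^sub>R v c"
  have y0: "y \<noteq> 0" using a m by (simp add: y_def)
  have "y = (\<chi> i. if i = k then sgn (v c $ k) else restrict (\<lambda>i. y $ i) (UNIV - {k}) i)"
    using m k by (auto simp: vec_eq_iff y_def sgn_if)
  moreover have "restrict (\<lambda>i. y $ i) (UNIV - {k}) \<in> (UNIV - {k} \<rightarrow>\<^sub>E {-1..1})"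
  proof -
    have "\<bar>y $ i\<bar> \<le> 1" for i using le[of i] m by (simp add: y_def)
    then show ?thesis by (auto simp: abs_le_iff minus_le_iff)
  qed
  moreover have "sgn (v c $ k) \<in> {-1, 1}" using k m by (auto simp: sgn_if)
  ultimately have "y \<in> ?Q" by blast
  moreover have "finsler_coord A F c (snd c p, y) = 1 / m"
    using finsler_coord_eq[OF y0] F_scale[of "1 / m" "v c"] v m by (simp add: y_def)
  then have "v = ?\<rho> y" using v m by (simp add: y_def)
  ultimately show "v \<in> ?\<rho> ` ?Q" by blast
qed

end

end

theory Submission
  imports Defs
begin

text \<open>
  Fix a point \<open>p\<close> and write \<open>Y^*\<close> for the pull-back of a vector field \<open>Y\<close>. The first structure
  equation \<open>dx^j \<and> \<omega>^i_j = 0\<close> says that the connection forms kill vertical vectors and that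
  \<open>\<omega>^i_j = \<Gamma>^i_{jk} dx^k\<close> with \<open>\<Gamma>\<close> symmetric in its lower indices. Since a horizontal lift
  projects to the vector that it lifts, this gives, at every \<open>u = (p, v)\<close> with \<open>v \<noteq> 0\<close>,
  \<open>D_{lift X} Y^* - D_{lift Y} X^* = [X, Y]_p\<close>: the derivatives of the components form the
  bracket and the symmetric \<open>\<Gamma>\<close>-terms cancel (\<open>chern_rund_coefficients\<close>). Both connection terms
  depend on \<open>u\<close>, but their difference does not, so its average over the indicatrix is \<open>[X, Y]_p\<close>.

  Averaging is linear and fixes constants only because the integrals converge and the volume is
  nonzero, and this is the analytic part of the proof. On each face of the cube, both the density
  of the volume form and the connection terms are continuous functions on a compact set
  (\<open>radial_density_continuous\<close>, \<open>cube_face_integrable\<close>), and the density does not vanish because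
  the fundamental tensor is nondegenerate and the radial direction is transversal to the
  indicatrix (\<open>radial_density_pos\<close>).
\<close>

section \<open>Composition with a projection and abstract tangent vectors\<close>

lemma Ck_on_cong:
  assumes "open S" "Ck_on k S f" "\<And>x. x \<in> S \<Longrightarrow> f x = g x"
  shows "Ck_on k S g"
  using assms(2,3)
proof (induction k arbitrary: f g)
  case 0
  then show ?case by (auto cong: continuous_on_cong)
next
  case (Suc k)
  have df: "f differentiable at x" if "x \<in> S" for x
    using Suc.prems(1) assms(1) that by (simp add: differentiable_on_eq_differentiable_at)
  have dg: "(g has_derivative frechet_derivative f (at x)) (at x)" if "x \<in> S" for x
    using df[OF that] has_derivative_transform_within_open[OF _ assms(1) that Suc.prems(2)]
    by (auto simp: frechet_derivative_works)
  have "g differentiable_on S"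
    using dg unfolding differentiable_on_eq_differentiable_at[OF assms(1)] differentiable_def by blast
  moreover have "Ck_on k S (\<lambda>x. frechet_derivative g (at x) v)" for v
    by (rule Suc.IH[of "\<lambda>x. frechet_derivative f (at x) v"])
      (use Suc.prems(1) frechet_derivative_at[OF dg] in \<open>auto simp: fun_eq_iff\<close>)
  ultimately show ?case by simp
qed

text \<open>The derivative of \<open>g \<circ> fst\<close> in direction \<open>v\<close> is again of this form, with \<open>g\<close> replaced by its
  derivative in direction \<open>fst v\<close>, so the order of differentiability is inherited by induction. It
  is used for pull-backs of vector fields to the tangent bundle.\<close>

lemma Ck_on_comp_fst:
  fixes g :: "'a::euclidean_space \<Rightarrow> 'c::real_normed_vector"
    and T :: "'b::euclidean_space set"
  assumes "open S" "open T" "Ck_on k S g"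
  shows "Ck_on k (S \<times> T) (\<lambda>w. g (fst w))"
  using assms(3)
proof (induction k arbitrary: g)
  case 0
  then show ?case by (auto intro!: continuous_on_compose2[of S g] continuous_intros)
next
  case (Suc k)
  have oST: "open (S \<times> T)" using assms by (simp add: open_Times)
  have d: "((\<lambda>w. g (fst w)) has_derivative (\<lambda>v. frechet_derivative g (at (fst w)) (fst v))) (at w)"
    if "w \<in> S \<times> T" for w
  proof -
    have "(g has_derivative frechet_derivative g (at (fst w))) (at (fst w))"
      using Suc.prems assms(1) that
      by (auto simp: differentiable_on_eq_differentiable_at simp flip: frechet_derivative_works)
    from diff_chain_at[OF has_derivative_fst[OF has_derivative_ident], of g, simplified, OF this]
    show ?thesis by (simp add: o_def)
  qed
  have "(\<lambda>w. g (fst w)) differentiable_on S \<times> T"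
    using d unfolding differentiable_on_eq_differentiable_at[OF oST] differentiable_def by blast
  moreover have "Ck_on k (S \<times> T) (\<lambda>w. frechet_derivative (\<lambda>w. g (fst w)) (at w) v)" for v
  proof (rule Ck_on_cong[OF oST])
    show "Ck_on k (S \<times> T) (\<lambda>w. frechet_derivative g (at (fst w)) (fst v))"
      using Suc.IH[of "\<lambda>x. frechet_derivative g (at x) (fst v)"] Suc.prems by simp
    fix w assume "w \<in> S \<times> T"
    from frechet_derivative_at[OF d[OF this]]
    show "frechet_derivative g (at (fst w)) (fst v) = frechet_derivative (\<lambda>w. g (fst w)) (at w) v"
      by metis
  qed
  ultimately show ?case by simp
qed

text \<open>The components of \<open>tvec_of\<close> in two charts are related by the chain rule. The hypotheses are
  those that can be read off from the natural charts of the slit tangent bundle, which is given by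
  its atlas alone.\<close>

lemma tangent_vectorI:
  assumes "e \<in> B" "u \<in> fst e"
    and inv: "\<And>d q. d \<in> B \<Longrightarrow> q \<in> fst d \<Longrightarrow> chart_inv d (snd d q) = q"
    and op: "\<And>d d'. d \<in> B \<Longrightarrow> d' \<in> B \<Longrightarrow> open (snd d ` (fst d \<inter> fst d'))"
    and der: "\<And>d d'. d \<in> B \<Longrightarrow> d' \<in> B \<Longrightarrow> u \<in> fst d \<Longrightarrow> u \<in> fst d' \<Longrightarrow>
      (snd d' \<circ> chart_inv d) differentiable (at (snd d u))"
  shows "tvec_of B e u a \<in> tangent_space B u"
proof -
  let ?D = "\<lambda>d d'. frechet_derivative (snd d' \<circ> chart_inv d) (at (snd d u))"
  have key: "?D e d' a = ?D d d' (?D e d a)"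
    if d: "d \<in> B" "u \<in> fst d" "d' \<in> B" "u \<in> fst d'" for d d'
  proof -
    let ?f = "snd d \<circ> chart_inv e" and ?g = "snd d' \<circ> chart_inv d"
    have eq: "?f (snd e u) = snd d u" using inv assms(1,2) by simp
    have "((?g \<circ> ?f) has_derivative (?D d d' \<circ> ?D e d)) (at (snd e u))"
      using der[OF assms(1) d(1) assms(2) d(2)] der[OF d(1,3,2,4)]
      by (intro diff_chain_at) (simp_all only: eq frechet_derivative_works)
    then have "((snd d' \<circ> chart_inv e) has_derivative (?D d d' \<circ> ?D e d)) (at (snd e u))"
    proof (rule has_derivative_transform_within_open)
      show "open (snd e ` (fst e \<inter> fst d))" by (rule op[OF assms(1) d(1)])
    qed (use assms(1,2) d inv[OF d(1)] inv[OF assms(1)] in auto)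
    then show ?thesis by (simp flip: frechet_derivative_at)
  qed
  have v: "tvec_of B e u a d = ?D e d a" if "d \<in> B" "u \<in> fst d" for d
    using that by (simp add: tvec_of_def)
  show ?thesis
    unfolding tangent_space_def
  proof (intro CollectI conjI allI ballI impI)
    fix d d' assume de: "d \<in> B" "d' \<in> B" "u \<in> fst d" "u \<in> fst d'"
    show "tvec_of B e u a d' = ?D d d' (tvec_of B e u a d)"
      unfolding v[OF de(1,3)] v[OF de(2,4)] by (rule key[OF de(1,3,2,4)])
  qed (auto simp: tvec_of_def)
qed

section \<open>The slit tangent bundle and horizontal lifts\<close>

context
  fixes M :: "'m topology" and A :: "('m, real ^ 'n::finite) chart set"
  assumes M: "smooth_manifold M A"
begin

lemma chart_range_open: "c \<in> A \<Longrightarrow> open (chart_range c)"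
  using M by (auto simp: smooth_manifold_def)

lemma slit_chart_inv_eq:
  assumes "c \<in> A" "w \<in> chart_range (slit_chart A c)"
  shows "chart_inv (slit_chart A c) w
    = (chart_inv c (fst w), tvec_of A c (chart_inv c (fst w)) (snd w))"
proof -
  obtain p a where "w = (snd c p, a)" "p \<in> fst c" "a \<noteq> 0"
    using assms(2) unfolding slit_chart_range[OF M assms(1)]
    by (cases w) (auto simp: chart_range_def)
  then show ?thesis
    using slit_chart_inv(1)[OF M assms(1)] chart_inv_coord[OF M assms(1)] by simp
qed

lemma slit_point:
  assumes "c \<in> A" "u \<in> fst (slit_chart A c)"
  shows "fst u \<in> fst c" "snd u \<in> tangent_space A (fst u)" "snd u c \<noteq> 0"
    "snd (slit_chart A c) u = (snd c (fst u), snd u c)"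
    "u = (fst u, tvec_of A c (fst u) (snd u c))"
proof -
  show 1: "fst u \<in> fst c" "snd u \<in> tangent_space A (fst u)"
    and im: "snd (slit_chart A c) u = (snd c (fst u), snd u c)"
    using assms(2) by (auto simp: slit_chart_def)
  show "u = (fst u, tvec_of A c (fst u) (snd u c))"
    using tvec_of_components[OF assms(1) 1] by simp
  have "snd (slit_chart A c) u \<in> chart_range (slit_chart A c)"
    using assms(2) by (simp add: chart_range_def)
  then show "snd u c \<noteq> 0" using slit_chart_range[OF M assms(1)] im by auto
qed

lemma slit_chart_inv_coord:
  assumes "c \<in> A" "u \<in> fst (slit_chart A c)"
  shows "chart_inv (slit_chart A c) (snd (slit_chart A c) u) = u"
  using slit_point[OF assms] slit_chart_inv(1)[OF M assms(1), of "fst u" "snd u c"] by simp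

lemma slit_overlap:
  assumes c: "c \<in> A" and d: "d \<in> A"
  shows "snd (slit_chart A c) ` (fst (slit_chart A c) \<inter> fst (slit_chart A d))
    = snd c ` (fst c \<inter> fst d) \<times> (UNIV - {0})"
proof (intro subset_antisym subsetI)
  fix w assume "w \<in> snd (slit_chart A c) ` (fst (slit_chart A c) \<inter> fst (slit_chart A d))"
  then obtain u where "w = snd (slit_chart A c) u" "u \<in> fst (slit_chart A c)"
    "u \<in> fst (slit_chart A d)" by blast
  then show "w \<in> snd c ` (fst c \<inter> fst d) \<times> (UNIV - {0})"
    using slit_point[OF c, of u] slit_point(1)[OF d, of u] by auto
next
  fix w assume "w \<in> snd c ` (fst c \<inter> fst d) \<times> (UNIV - {0::real^'n})"
  then obtain p a where w: "w = (snd c p, a)" "p \<in> fst c" "p \<in> fst d" "a \<noteq> 0" by auto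
  let ?u = "(p, tvec_of A c p a)"
  have u: "?u \<in> fst (slit_chart A c)" by (rule slit_chart_inv(3)[OF M c w(2,4)])
  then have "?u \<in> fst (slit_chart A d)" using w(3) by (simp add: slit_chart_def)
  moreover have "w = snd (slit_chart A c) ?u"
    using slit_point(4)[OF c u] tvec_of_chart[OF M c w(2)] w(1) by simp
  ultimately show "w \<in> snd (slit_chart A c) ` (fst (slit_chart A c) \<inter> fst (slit_chart A d))"
    using u by blast
qed

text \<open>In natural coordinates the transition is \<open>(x, y) \<mapsto> (\<phi> x, D\<phi>(x) y)\<close>. The first component of
  its derivative sees only the \<open>x\<close>-direction, which is how \<open>dx\<close> of a tangent vector of the slit
  bundle transforms like a tangent vector of the base; the second component \<open>H\<close> involves second
  derivatives of \<open>\<phi>\<close>.\<close>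

lemma slit_transition_has_derivative:
  assumes c: "c \<in> A" and d: "d \<in> A" and p: "p \<in> fst c" "p \<in> fst d" and a: "a \<noteq> 0"
  obtains H where "((snd (slit_chart A d) \<circ> chart_inv (slit_chart A c)) has_derivative
      (\<lambda>z. (frechet_derivative (snd d \<circ> chart_inv c) (at (snd c p)) (fst z), H z)))
      (at (snd c p, a))"
proof -
  let ?\<phi> = "snd d \<circ> chart_inv c"
  let ?S = "snd c ` (fst c \<inter> fst d)"
  have oS: "open ?S" by (rule transition_domain_open[OF M c d])
  have "Ck_on (Suc (Suc 0)) ?S ?\<phi>"
    using M c d unfolding smooth_manifold_def smooth_on_def by blast
  then have dd: "(\<lambda>x. frechet_derivative ?\<phi> (at x) b) differentiable (at (snd c p))" for b
    using oS p by (simp add: differentiable_on_eq_differentiable_at)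
  have d1: "((\<lambda>w. ?\<phi> (fst w)) has_derivative
      (\<lambda>z. frechet_derivative ?\<phi> (at (snd c p)) (fst z))) (at (snd c p, a))"
    using diff_chain_at[OF has_derivative_fst[OF has_derivative_ident], of ?\<phi> _ "(snd c p, a)",
        simplified] transition_has_derivative[OF M c d p] by (simp add: o_def)
  have db: "(\<lambda>w. frechet_derivative ?\<phi> (at (fst w)) b) differentiable (at (snd c p, a))" for b
    using differentiable_chain_at[of fst "(snd c p, a)" "\<lambda>x. frechet_derivative ?\<phi> (at x) b"] dd
    by (simp add: o_def bounded_linear_imp_differentiable bounded_linear_fst)
  \<comment> \<open>Smoothness of \<open>\<phi>\<close> controls \<open>x \<mapsto> D\<phi>(x) b\<close> for fixed \<open>b\<close> only, so \<open>y\<close> is expanded in a basis.\<close>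
  have "(\<lambda>w. \<Sum>b\<in>Basis. (snd w \<bullet> b) *\<^sub>R frechet_derivative ?\<phi> (at (fst w)) b)
      differentiable (at (snd c p, a))"
  proof (intro differentiable_sum differentiable_scaleR db ballI)
    show "(\<lambda>w. snd w \<bullet> b) differentiable (at (snd c p, a))" for b :: "real ^ 'n"
      by (auto intro!: bounded_linear_imp_differentiable bounded_linear_inner_left_comp bounded_linear_snd)
  qed simp
  then obtain H where H: "((\<lambda>w. \<Sum>b\<in>Basis. (snd w \<bullet> b) *\<^sub>R frechet_derivative ?\<phi> (at (fst w)) b)
      has_derivative H) (at (snd c p, a))"
    unfolding differentiable_def by blast
  have "((snd (slit_chart A d) \<circ> chart_inv (slit_chart A c)) has_derivative
      (\<lambda>z. (frechet_derivative ?\<phi> (at (snd c p)) (fst z), H z))) (at (snd c p, a))"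
  proof (rule has_derivative_transform_within_open[OF has_derivative_Pair[OF d1 H]])
    show "open (?S \<times> (UNIV - {0::real^'n}))" using oS by (intro open_Times) auto
    show "(snd c p, a) \<in> ?S \<times> (UNIV - {0})" using p a by auto
    fix w assume "w \<in> ?S \<times> (UNIV - {0::real^'n})"
    then obtain q b where w: "w = (snd c q, b)" "q \<in> fst c" "q \<in> fst d" "b \<noteq> 0" by auto
    have lin: "linear (frechet_derivative ?\<phi> (at (snd c q)))"
      using transition_has_derivative[OF M c d w(2,3)] has_derivative_linear by blast
    have "frechet_derivative ?\<phi> (at (snd c q)) b
        = frechet_derivative ?\<phi> (at (snd c q)) (\<Sum>i\<in>Basis. (b \<bullet> i) *\<^sub>R i)"
      by (simp only: euclidean_representation)
    also have "\<dots> = (\<Sum>i\<in>Basis. (b \<bullet> i) *\<^sub>R frechet_derivative ?\<phi> (at (snd c q)) i)"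
      by (simp add: linear_sum[OF lin] linear_scale[OF lin])
    finally have "frechet_derivative ?\<phi> (at (snd c q)) b = \<dots>" .
    moreover have "(snd (slit_chart A d) \<circ> chart_inv (slit_chart A c)) w
        = (snd d q, frechet_derivative ?\<phi> (at (snd c q)) b)"
      using slit_chart_inv(1)[OF M c w(2,4)] w(1,3) d by (simp add: slit_chart_def tvec_of_def)
    ultimately show "(?\<phi> (fst w), \<Sum>b\<in>Basis. (snd w \<bullet> b) *\<^sub>R frechet_derivative ?\<phi> (at (fst w)) b)
        = (snd (slit_chart A d) \<circ> chart_inv (slit_chart A c)) w"
      using w(1) chart_inv_coord[OF M c w(2)] by simp
  qed
  then show thesis by (rule that)
qed

lemma slit_tangent_vector:
  assumes "c \<in> A" "u \<in> fst (slit_chart A c)"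
  shows "tvec_of (slit_atlas A) (slit_chart A c) u a \<in> tangent_space (slit_atlas A) u"
proof (rule tangent_vectorI)
  fix e e' assume "e \<in> slit_atlas A" "e' \<in> slit_atlas A"
  then obtain c d where e: "e = slit_chart A c" "e' = slit_chart A d" "c \<in> A" "d \<in> A"
    by (auto simp: slit_atlas_def)
  have "open (snd c ` (fst c \<inter> fst d))" by (rule transition_domain_open[OF M e(3,4)])
  then show "open (snd e ` (fst e \<inter> fst e'))"
    unfolding e(1,2) slit_overlap[OF e(3,4)] by (intro open_Times) auto
  assume u: "u \<in> fst e" "u \<in> fst e'"
  then obtain H where "((snd e' \<circ> chart_inv e) has_derivative H) (at (snd c (fst u), snd u c))"
    using slit_transition_has_derivative[OF e(3,4), of "fst u" "snd u c"]
      slit_point(1,3)[OF e(3), of u] slit_point(1)[OF e(4), of u] unfolding e(1,2) by metis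
  then show "(snd e' \<circ> chart_inv e) differentiable (at (snd e u))"
    using u(1) slit_point(4)[OF e(3), of u] unfolding differentiable_def e(1) by auto
qed (use assms slit_chart_inv_coord in \<open>auto simp: slit_atlas_def\<close>)

lemma chart_at_chart:
  assumes "c \<in> A" "p \<in> fst c"
  shows "chart_at A p \<in> A" "p \<in> fst (chart_at A p)"
  using someI[of "\<lambda>c. c \<in> A \<and> p \<in> fst c" c] assms by (auto simp: chart_at_def)

text \<open>The lift is defined in the chart selected by \<open>chart_at\<close>. In any other natural chart its
  \<open>dx\<close>-part is still the component vector of \<open>X\<close>, because \<open>dx\<close>-parts transform by the
  derivative of the coordinate change of the base.\<close>

lemma horizontal_lift:
  assumes c: "c \<in> A" and u: "u \<in> fst (slit_chart A c)" and X: "X \<in> tangent_space A (fst u)"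
  shows "horizontal_lift A F u X \<in> tangent_space (slit_atlas A) u"
    and "fst (horizontal_lift A F u X (slit_chart A c)) = X c"
proof -
  define c0 where "c0 = chart_at A (fst u)"
  note p = slit_point(1)[OF c u]
  note c0 = chart_at_chart[OF c p, folded c0_def]
  have u0: "u \<in> fst (slit_chart A c0)" using u c0 by (auto simp: slit_chart_def)
  define b where "b = (\<chi> j. - (\<Sum>i\<in>UNIV.
    nonlin (finsler_coord A F c0) (snd (slit_chart A c0) u) j i * X c0 $ i))"
  have lift: "horizontal_lift A F u X = tvec_of (slit_atlas A) (slit_chart A c0) u (X c0, b)"
    by (simp add: horizontal_lift_def Let_def b_def c0_def)
  show "horizontal_lift A F u X \<in> tangent_space (slit_atlas A) u"
    unfolding lift by (rule slit_tangent_vector[OF c0(1) u0])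
  obtain H where H: "((snd (slit_chart A c) \<circ> chart_inv (slit_chart A c0)) has_derivative
      (\<lambda>z. (frechet_derivative (snd c \<circ> chart_inv c0) (at (snd c0 (fst u))) (fst z), H z)))
      (at (snd (slit_chart A c0) u))"
    unfolding slit_point(4)[OF c0(1) u0]
    by (rule slit_transition_has_derivative[OF c0(1) c c0(2) p slit_point(3)[OF c0(1) u0]])
  have "X c = frechet_derivative (snd c \<circ> chart_inv c0) (at (snd c0 (fst u))) (X c0)"
    using X c c0 p unfolding tangent_space_def by blast
  then show "fst (horizontal_lift A F u X (slit_chart A c)) = X c"
    using c u by (simp add: lift tvec_of_def slit_atlas_def flip: frechet_derivative_at[OF H])
qed

lemma smooth_section_pullback:
  assumes "smooth_vector_field A Y"
  shows "smooth_section A (\<lambda>u. Y (fst u))"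
  unfolding smooth_section_def
proof (intro conjI ballI)
  fix u assume "u \<in> carrier_of (slit_atlas A)"
  then have "fst u \<in> carrier_of A"
    by (fastforce simp: carrier_of_def slit_atlas_def slit_chart_def)
  then show "Y (fst u) \<in> tangent_space A (fst u)"
    using assms by (simp add: smooth_vector_field_def)
next
  fix c assume c: "c \<in> A"
  note V = slit_chart_range[OF M c]
  have o: "open (UNIV - {0::real^'n})" by auto
  have "Ck_on k (chart_range c) (\<lambda>x. Y (chart_inv c x) c)" for k
    using assms c unfolding smooth_vector_field_def smooth_on_def by blast
  then have "Ck_on k (chart_range (slit_chart A c)) (\<lambda>w. Y (chart_inv c (fst w)) c)" for k
    unfolding V by (rule Ck_on_comp_fst[OF chart_range_open[OF c] o])
  then have "Ck_on k (chart_range (slit_chart A c))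
      (\<lambda>w. Y (fst (chart_inv (slit_chart A c) w)) c)" for k
    by (rule Ck_on_cong[rotated])
      (use V chart_range_open[OF c] open_Times o slit_chart_inv_eq[OF c] in auto)
  then show "smooth_on (chart_range (slit_chart A c))
      (\<lambda>w. Y (fst (chart_inv (slit_chart A c) w)) c)"
    by (simp add: smooth_on_def)
qed

end

section \<open>The horizontal coefficients of the connection\<close>

text \<open>\<open>\<Gamma> i j w \<xi>\<close> is \<open>\<Gamma>^i_{jk}(w) \<xi>^k\<close>. Evaluating \<open>dx^j \<and> \<omega>^i_j = 0\<close> on a horizontal and a
  vertical coordinate vector shows \<open>\<omega>^i_j(0, b) = 0\<close>; evaluating it on two vectors without
  vertical part gives the symmetry. The continuity in \<open>w\<close> is what makes the average converge.\<close>

lemma chern_rund_coefficients: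
  fixes A :: "('m, real ^ 'n::finite) chart set"
  assumes M: "smooth_manifold M A" and D: "chern_rund_connection A F D" and c: "c \<in> A"
  obtains \<Gamma> where
    "\<And>i j \<xi>. continuous_on (chart_range (slit_chart A c)) (\<lambda>w. \<Gamma> i j w \<xi>)"
    "\<And>i w \<xi> \<eta>. w \<in> chart_range (slit_chart A c) \<Longrightarrow>
       (\<Sum>j\<in>UNIV. \<Gamma> i j w \<xi> * \<eta> $ j) = (\<Sum>j\<in>UNIV. \<Gamma> i j w \<eta> * \<xi> $ j)"
    "\<And>u X Y. u \<in> fst (slit_chart A c) \<Longrightarrow> X \<in> tangent_space A (fst u) \<Longrightarrow>
       smooth_vector_field A Y \<Longrightarrow>
       D u (horizontal_lift A F u X) (\<lambda>w. Y (fst w)) c =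
         frechet_derivative (\<lambda>x. Y (chart_inv c x) c) (at (snd c (fst u))) (X c)
         + (\<chi> i. \<Sum>j\<in>UNIV. \<Gamma> i j (snd (slit_chart A c) u) (X c) * Y (fst u) c $ j)"
proof -
  define e where "e = slit_chart A c"
  define V where "V = chart_range e"
  have "\<exists>\<omega>. connection_forms A D c \<omega> \<and> (\<forall>w\<in>V.
      (\<forall>i z z'. ext_deriv (dx i) w z z' - (\<Sum>j\<in>UNIV. wedge (dx j) (\<omega> i j) w z z') = 0))"
    using D c unfolding chern_rund_connection_def Let_def V_def e_def by fast
  then obtain \<omega> where conn: "connection_forms A D c \<omega>"
    and tors: "\<And>w i z z'. w \<in> V \<Longrightarrow>
      ext_deriv (dx i) w z z' - (\<Sum>j\<in>UNIV. wedge (dx j) (\<omega> i j) w z z') = 0"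
    by blast
  have lin: "linear (\<omega> i j w)" if "w \<in> V" for i j w
    using conn that unfolding connection_forms_def smooth_form1_def Let_def V_def e_def by blast
  have cont: "continuous_on V (\<lambda>w. \<omega> i j w z)" for i j z
  proof -
    have "Ck_on 0 V (\<lambda>w. \<omega> i j w z)"
      using conn unfolding connection_forms_def smooth_form1_def smooth_on_def Let_def V_def e_def
      by blast
    then show ?thesis by simp
  qed
  \<comment> \<open>The form \<open>dx^i\<close> has constant coefficients, so \<open>d(dx^i) = 0\<close>.\<close>
  have eq: "(\<Sum>j\<in>UNIV. fst z $ j * \<omega> i j w z') = (\<Sum>j\<in>UNIV. fst z' $ j * \<omega> i j w z)"
    if "w \<in> V" for i w z z'
    using tors[OF that, of i z z'] by (simp add: ext_deriv_def wedge_def dx_def sum_subtractf)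
  have vert: "\<omega> i j w (0, b) = 0" if "w \<in> V" for i j w b
  proof -
    have "(\<Sum>l\<in>UNIV. (axis j 1 :: real ^ 'n) $ l * \<omega> i l w (0, b)) = \<omega> i j w (0, b)"
      by (simp add: axis_def if_distrib[of "\<lambda>t. t * _"] sum.If_cases)
    with eq[OF that, of "(axis j 1, 0)" i "(0, b)"] show ?thesis by simp
  qed
  have hor: "\<omega> i j w z = \<omega> i j w (fst z, 0)" if "w \<in> V" for i j w z
    using linear_add[OF lin[OF that], of i j "(fst z, 0)" "(0, snd z)"] vert[OF that] by simp
  show thesis
  proof (rule that)
    show "continuous_on (chart_range (slit_chart A c)) (\<lambda>w. \<omega> i j w (\<xi>, 0))" for i j \<xi>
      using cont by (simp add: V_def e_def)
    show "(\<Sum>j\<in>UNIV. \<omega> i j w (\<xi>, 0) * \<eta> $ j) = (\<Sum>j\<in>UNIV. \<omega> i j w (\<eta>, 0) * \<xi> $ j)"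
      if "w \<in> chart_range (slit_chart A c)" for i w \<xi> \<eta>
      using eq[of w "(\<xi>, 0)" i "(\<eta>, 0)"] that by (simp add: V_def e_def mult.commute)
  next
    fix u X Y
    assume u: "u \<in> fst (slit_chart A c)" and X: "X \<in> tangent_space A (fst u)"
      and Y: "smooth_vector_field A Y"
    let ?z = "horizontal_lift A F u X"
    let ?Y = "\<lambda>x. Y (chart_inv c x) c"
    have w: "snd e u \<in> V" using u by (simp add: V_def e_def chart_range_def)
    have p: "fst u \<in> fst c" "snd e u = (snd c (fst u), snd u c)"
      using slit_point[OF M c u] by (auto simp: e_def)
    have V: "V = chart_range c \<times> (UNIV - {0})"
      unfolding V_def e_def by (rule slit_chart_range[OF M c])
    have oV: "open V" unfolding V using chart_range_open[OF M c] by (intro open_Times) auto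
    have "Ck_on (Suc 0) (chart_range c) ?Y"
      using Y c unfolding smooth_vector_field_def smooth_on_def by blast
    then have "(?Y has_derivative frechet_derivative ?Y (at (snd c (fst u)))) (at (snd c (fst u)))"
      using chart_range_open[OF M c] p
      by (simp add: differentiable_on_eq_differentiable_at chart_range_def
          flip: frechet_derivative_works)
    from has_derivative_compose[OF has_derivative_fst[OF has_derivative_ident, of "at (snd e u)"],
        unfolded p(2), simplified, OF this]
    have dY: "((\<lambda>w. ?Y (fst w)) has_derivative
        (\<lambda>z. frechet_derivative ?Y (at (snd c (fst u))) (fst z))) (at (snd e u))"
      by (simp add: p(2))
    have "((\<lambda>w. Y (fst (chart_inv e w)) c) has_derivative
        (\<lambda>z. frechet_derivative ?Y (at (snd c (fst u))) (fst z))) (at (snd e u))"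
      by (rule has_derivative_transform_within_open[OF dY oV w])
        (use slit_chart_inv_eq[OF M c] in \<open>simp add: V_def e_def\<close>)
    then have "((\<lambda>w. Y (fst (chart_inv e w)) c $ i) has_derivative
        (\<lambda>z. frechet_derivative ?Y (at (snd c (fst u))) (fst z) $ i)) (at (snd e u))" for i
      by (rule bounded_linear.has_derivative[OF bounded_linear_vec_nth])
    note dYi = frechet_derivative_at[OF this, symmetric]
    have "D u ?z (\<lambda>w. Y (fst w)) c $ i =
        frechet_derivative (\<lambda>w. Y (fst (chart_inv e w)) c $ i) (at (snd e u)) (?z e)
        + (\<Sum>j\<in>UNIV. \<omega> i j (snd e u) (?z e) * Y (fst u) c $ j)" for i
      using conn smooth_section_pullback[OF M Y] u horizontal_lift(1)[OF M c u X]
      unfolding connection_forms_def Let_def e_def by blast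
    moreover have "fst (?z e) = X c" unfolding e_def by (rule horizontal_lift(2)[OF M c u X])
    ultimately show "D u ?z (\<lambda>w. Y (fst w)) c =
        frechet_derivative ?Y (at (snd c (fst u))) (X c)
        + (\<chi> i. \<Sum>j\<in>UNIV. \<omega> i j (snd (slit_chart A c) u) (X c, 0) * Y (fst u) c $ j)"
      by (intro vec_eq_iff[THEN iffD2] allI)
        (simp add: dYi hor[OF w, of _ _ "?z e"] flip: e_def)
  qed
qed

section \<open>Integration over the faces of the cube\<close>

lemma cube_face_measurable:
  "(\<lambda>s. \<chi> i. if i = k then \<sigma> else s i) \<in>
     (\<Pi>\<^sub>M i\<in>UNIV - {k}. lborel) \<rightarrow>\<^sub>M (borel :: (real ^ 'n::finite) measure)"
proof -
  have "(\<lambda>s. if i = k then \<sigma> else s i) \<in> borel_measurable (\<Pi>\<^sub>M i\<in>UNIV - {k}. lborel)"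
    for i :: 'n
    by (cases "i = k") (auto intro: measurable_component_singleton)
  then show ?thesis
    by (subst borel_measurable_euclidean_space) (auto simp: Basis_vec_def inner_axis)
qed

lemma cube_face_compact:
  "compact {y :: real ^ 'n::finite. y $ k = \<sigma> \<and> (\<forall>i. \<bar>y $ i\<bar> \<le> 1)}"
proof -
  have "closed {y :: real ^ 'n. y $ k = \<sigma> \<and> (\<forall>i. \<bar>y $ i\<bar> \<le> 1)}"
    by (intro closed_Collect_conj closed_Collect_all closed_Collect_eq closed_Collect_le
        continuous_intros)
  moreover have "bounded {y :: real ^ 'n. y $ k = \<sigma> \<and> (\<forall>i. \<bar>y $ i\<bar> \<le> 1)}"
    by (rule bounded_subset[OF bounded_cbox[of "- 1" 1]])
      (auto simp: mem_box_cart abs_le_iff minus_le_iff)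
  ultimately show ?thesis by (simp add: compact_eq_bounded_closed)
qed

lemma cube_face_finite_measure:
  fixes I :: "'n::finite set"
  shows "(I \<rightarrow>\<^sub>E {-1..1}) \<in> sets (\<Pi>\<^sub>M i\<in>I. lborel :: real measure)"
    "emeasure (\<Pi>\<^sub>M i\<in>I. lborel :: real measure) (I \<rightarrow>\<^sub>E {-1..1}) = 2 ^ card I"
proof -
  interpret product_sigma_finite "\<lambda>i :: 'n. lborel :: real measure" ..
  show "(I \<rightarrow>\<^sub>E {-1..1}) \<in> sets (\<Pi>\<^sub>M i\<in>I. lborel :: real measure)"
    by (intro sets_PiM_I_finite) auto
  show "emeasure (\<Pi>\<^sub>M i\<in>I. lborel :: real measure) (I \<rightarrow>\<^sub>E {-1..1}) = 2 ^ card I"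
    by (subst emeasure_PiM) auto
qed

text \<open>The face is compact and misses the origin, so \<open>g\<close> is bounded on it, and the face has finite
  measure. Continuity is asked for away from \<open>0\<close> because the radial projection, which enters the
  integrands, has no continuous extension to \<open>0\<close>.\<close>

lemma cube_face_integrable:
  fixes g :: "real ^ 'n::finite \<Rightarrow> 'b::{banach, second_countable_topology}"
  assumes g: "continuous_on (UNIV - {0}) g" and \<sigma>: "\<sigma> \<in> {-1, 1}"
  shows "set_integrable (\<Pi>\<^sub>M i\<in>UNIV - {k}. lborel) (UNIV - {k} \<rightarrow>\<^sub>E {-1..1})
    (\<lambda>s. g (\<chi> i. if i = k then \<sigma> else s i))"
proof -
  let ?P = "\<Pi>\<^sub>M i\<in>UNIV - {k}. lborel :: real measure"
  let ?S = "UNIV - {k} \<rightarrow>\<^sub>E {-1..1::real}"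
  let ?y = "\<lambda>s. \<chi> i. if i = k then \<sigma> else s i"
  define K where "K = ({y. y $ k = \<sigma> \<and> (\<forall>i. \<bar>y $ i\<bar> \<le> 1)} :: (real ^ 'n) set)"
  have K: "compact K" unfolding K_def by (rule cube_face_compact)
  have yK: "?y s \<in> K" if "s \<in> ?S" for s
    using that \<sigma> by (auto simp: K_def PiE_iff abs_le_iff minus_le_iff)
  have gK: "continuous_on K g"
    by (rule continuous_on_subset[OF g]) (use \<sigma> in \<open>auto simp: K_def\<close>)
  then obtain C where C: "norm (g y) \<le> C" if "y \<in> K" for y
    using compact_imp_bounded[OF compact_continuous_image[OF gK K]] by (auto simp: bounded_iff)
  have "(\<lambda>y. indicator K y *\<^sub>R g y) \<in> borel_measurable borel"
    using K gK by (intro borel_measurable_continuous_on_indicator) (auto simp: compact_imp_closed)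
  then have [measurable]: "(\<lambda>s. indicator K (?y s) *\<^sub>R g (?y s)) \<in> borel_measurable ?P"
    by (rule measurable_compose[OF cube_face_measurable])
  have "integrable ?P (\<lambda>s. indicator ?S s *\<^sub>R (indicator K (?y s) *\<^sub>R g (?y s)))"
    by (rule integrableI_bounded_set_indicator[where B = C])
      (use cube_face_finite_measure[of "UNIV - {k}"] C yK in
        \<open>auto simp: power_less_top_ennreal\<close>)
  also have "(\<lambda>s. indicator ?S s *\<^sub>R (indicator K (?y s) *\<^sub>R g (?y s)))
      = (\<lambda>s. indicator ?S s *\<^sub>R g (?y s))"
    using yK by (auto simp: indicator_def fun_eq_iff)
  finally show ?thesis by (simp add: set_integrable_def)
qed

text \<open>By compactness \<open>g\<close> attains a positive minimum on the face, and the face has positive measure.\<close>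

lemma cube_face_integral_pos:
  fixes g :: "real ^ 'n::finite \<Rightarrow> real"
  assumes g: "continuous_on (UNIV - {0}) g" and \<sigma>: "\<sigma> \<in> {-1, 1}"
    and pos: "\<And>y. y $ k = \<sigma> \<Longrightarrow> 0 < g y"
  shows "0 < (LINT s : (UNIV - {k} \<rightarrow>\<^sub>E {-1..1}) | (\<Pi>\<^sub>M i\<in>UNIV - {k}. lborel).
    g (\<chi> i. if i = k then \<sigma> else s i))"
proof -
  let ?P = "\<Pi>\<^sub>M i\<in>UNIV - {k}. lborel :: real measure"
  let ?S = "UNIV - {k} \<rightarrow>\<^sub>E {-1..1::real}"
  let ?y = "\<lambda>s. \<chi> i. if i = k then \<sigma> else s i"
  define K where "K = ({y. y $ k = \<sigma> \<and> (\<forall>i. \<bar>y $ i\<bar> \<le> 1)} :: (real ^ 'n) set)"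
  have K: "compact K" unfolding K_def by (rule cube_face_compact)
  have yK: "?y s \<in> K" if "s \<in> ?S" for s
    using that \<sigma> by (auto simp: K_def PiE_iff abs_le_iff minus_le_iff)
  have "(\<chi> i. \<sigma>) \<in> K" using \<sigma> by (auto simp: K_def)
  moreover have "continuous_on K g"
    by (rule continuous_on_subset[OF g]) (use \<sigma> in \<open>auto simp: K_def\<close>)
  ultimately obtain y0 where y0: "y0 \<in> K" and min: "\<And>y. y \<in> K \<Longrightarrow> g y0 \<le> g y"
    using continuous_attains_inf[OF K] by blast
  have "emeasure ?P ?S = ennreal (2 ^ card (UNIV - {k}))"
    using cube_face_finite_measure(2)[of "UNIV - {k}"] by (simp add: ennreal_power[symmetric])
  then have m: "measure ?P ?S = 2 ^ card (UNIV - {k})"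
    by (simp add: measure_def)
  have "0 < g y0 * 2 ^ card (UNIV - {k})" using pos y0 by (simp add: K_def)
  also have "\<dots> = (LINT s : ?S | ?P. g y0)"
    using cube_face_finite_measure(1)[of "UNIV - {k}"] m
    by (simp add: set_lebesgue_integral_def)
  also have "\<dots> \<le> (LINT s : ?S | ?P. g (?y s))"
  proof (rule set_integral_mono)
    show "set_integrable ?P ?S (\<lambda>s. g y0)"
      using cube_face_integrable[of "\<lambda>y. g y0" \<sigma> k] \<sigma> by auto
    show "set_integrable ?P ?S (\<lambda>s. g (?y s))"
      by (rule cube_face_integrable[OF g]) (use \<sigma> in auto)
  qed (use min yK in auto)
  finally show ?thesis .
qed

section \<open>The volume density of the indicatrix\<close>

lemma fund_continuous:
  fixes L :: "'n::finite coord \<Rightarrow> real"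
  assumes V: "open V" and L: "smooth_on V L"
  shows "continuous_on V (\<lambda>w. fund L w $ i $ j)"
proof -
  have C2: "Ck_on (Suc (Suc 0)) V L" using L unfolding smooth_on_def by blast
  have dL: "(L has_derivative frechet_derivative L (at w)) (at w)" if "w \<in> V" for w
    using C2 V that by (simp add: differentiable_on_eq_differentiable_at frechet_derivative_works)
  have dpd: "(pdy j L has_derivative frechet_derivative (pdy j L) (at w)) (at w)"
    if "w \<in> V" for j w
  proof -
    have "(\<lambda>w. frechet_derivative L (at w) (0, axis j 1)) differentiable_on V"
      using C2 by simp
    then show ?thesis
      using V that unfolding frechet_derivative_works[symmetric]
      by (simp add: differentiable_on_eq_differentiable_at pdy_def[abs_def])
  qed
  have sq: "pdy j (\<lambda>w. (L w)\<^sup>2) w = 2 * L w * pdy j L w" if "w \<in> V" for j w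
  proof -
    have "((\<lambda>w. (L w)\<^sup>2) has_derivative (\<lambda>v. 2 * L w * frechet_derivative L (at w) v)) (at w)"
      by (auto intro!: derivative_eq_intros dL[OF that] simp: ac_simps)
    from frechet_derivative_at[OF this, symmetric] show ?thesis by (simp add: pdy_def)
  qed
  \<comment> \<open>The product rule turns the second derivatives of \<open>L\<^sup>2\<close> into those of \<open>L\<close>.\<close>
  have fund: "fund L w $ i $ j = pdy i L w * pdy j L w + L w * pdy i (pdy j L) w"
    if "w \<in> V" for w
  proof -
    have "((\<lambda>w. 2 * L w * pdy j L w) has_derivative
        (\<lambda>v. 2 * (frechet_derivative L (at w) v * pdy j L w
          + L w * frechet_derivative (pdy j L) (at w) v))) (at w)"
      by (auto intro!: derivative_eq_intros dL[OF that] dpd[OF that] simp: algebra_simps)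
    then have "(pdy j (\<lambda>w. (L w)\<^sup>2) has_derivative
        (\<lambda>v. 2 * (frechet_derivative L (at w) v * pdy j L w
          + L w * frechet_derivative (pdy j L) (at w) v))) (at w)"
      by (rule has_derivative_transform_within_open[OF _ V that]) (simp add: sq)
    note d = frechet_derivative_at[OF this, symmetric]
    have "pdy i (pdy j (\<lambda>w. (L w)\<^sup>2)) w = 2 * (pdy i L w * pdy j L w + L w * pdy i (pdy j L) w)"
      by (simp only: pdy_def[of i] d)
    then show ?thesis by (simp add: fund_def)
  qed
  have cont: "continuous_on V L" "continuous_on V (pdy l L)"
    "continuous_on V (pdy i (pdy j L))" for l
  proof -
    show "continuous_on V L"
      using C2 by (simp add: differentiable_imp_continuous_on)
    have "(\<lambda>w. frechet_derivative L (at w) (0, axis l 1)) differentiable_on V"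
      using C2 by simp
    then show "continuous_on V (pdy l L)"
      by (simp add: differentiable_imp_continuous_on pdy_def[abs_def])
    have "continuous_on V (\<lambda>w. frechet_derivative
        (\<lambda>w. frechet_derivative L (at w) (0, axis j 1)) (at w) (0, axis i 1))"
      using C2 by simp
    then show "continuous_on V (pdy i (pdy j L))"
      by (simp add: pdy_def[abs_def])
  qed
  have "continuous_on V (\<lambda>w. pdy i L w * pdy j L w + L w * pdy i (pdy j L) w)"
    by (intro continuous_intros cont)
  then show ?thesis by (simp add: fund cong: continuous_on_cong)
qed

lemma det_nonzero_of_positive:
  fixes B :: "real ^ 'n::finite ^ 'n"
  assumes "\<And>a. a \<noteq> 0 \<Longrightarrow> a \<bullet> (B *v a) > 0"
  shows "det B \<noteq> 0"
proof -
  have "B *v a = 0 \<longrightarrow> a = 0" for a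
    using assms[of a] by (cases "a = 0") auto
  then show ?thesis
    using matrix_left_invertible_ker[of B] invertible_left_inverse[of B] invertible_det_nz[of B]
    by blast
qed

lemma continuous_on_det:
  fixes B :: "'a::topological_space \<Rightarrow> real ^ 'n::finite ^ 'n"
  assumes "\<And>i j. continuous_on S (\<lambda>x. B x $ i $ j)"
  shows "continuous_on S (\<lambda>x. det (B x))"
  unfolding det_def by (intro continuous_intros assms)

text \<open>On vertical vectors \<open>\<delta>y\<close> reduces to \<open>dy\<close>.\<close>

lemma indicatrix_form_vertical:
  "indicatrix_form L u k W = sqrt (det (fund L u)) *
     det (\<chi> i. (1 / L u) *\<^sub>R (if i = k then (1 / L u) *\<^sub>R snd u else W i))"
proof -
  have "delta_y L u (0, b) = b" for b by (simp add: delta_y_def vec_eq_iff)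
  then have "(\<chi> i. (1 / L u) *\<^sub>R delta_y L u (if i = k then (0, (1 / L u) *\<^sub>R snd u) else (0, W i)))
      = (\<chi> i. (1 / L u) *\<^sub>R (if i = k then (1 / L u) *\<^sub>R snd u else W i))"
    by (simp add: vec_eq_iff)
  then show ?thesis by (simp add: indicatrix_form_def)
qed

definition radial :: "('n::finite coord \<Rightarrow> real) \<Rightarrow> real ^ 'n \<Rightarrow> real ^ 'n \<Rightarrow> real ^ 'n" where
  "radial L x y = (1 / L (x, y)) *\<^sub>R y"

text \<open>The density of the volume form of the indicatrix, pulled back by the radial projection to the
  cube face orthogonal to the \<open>k\<close>-th axis.\<close>

definition radial_density ::
    "('n::finite coord \<Rightarrow> real) \<Rightarrow> real ^ 'n \<Rightarrow> 'n \<Rightarrow> real ^ 'n \<Rightarrow> real" where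
  "radial_density L x k y = \<bar>indicatrix_form L (x, radial L x y) k
     (\<lambda>i. frechet_derivative (radial L x) (at y) (axis i 1))\<bar>"

lemma indicatrix_integral_radial:
  "indicatrix_integral A F p f =
    (let c = chart_at A p; x = snd c p; L = finsler_coord A F c in
      \<Sum>\<sigma>\<in>{-1, 1}. \<Sum>k\<in>UNIV.
        LINT s : (UNIV - {k} \<rightarrow>\<^sub>E {-1..1}) | (\<Pi>\<^sub>M i\<in>UNIV - {k}. lborel).
          radial_density L x k (\<chi> i. if i = k then \<sigma> else s i)
            *\<^sub>R f (tvec_of A c p (radial L x (\<chi> i. if i = k then \<sigma> else s i))))"
  unfolding indicatrix_integral_def Let_def radial_density_def radial_def ..

context
  fixes M :: "'m topology" and A :: "('m, real ^ 'n::finite) chart set" and F c p L x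
  assumes fin: "finsler_space M A F" and c: "c \<in> A" and p: "p \<in> fst c"
  defines "L \<equiv> finsler_coord A F c" and "x \<equiv> snd c p"
begin

lemma coord_smooth:
  "open (chart_range (slit_chart A c))" "smooth_on (chart_range (slit_chart A c)) L"
  "y \<noteq> 0 \<Longrightarrow> (x, y) \<in> chart_range (slit_chart A c)"
proof -
  have M: "smooth_manifold M A" using fin by (simp add: finsler_space_def)
  show "open (chart_range (slit_chart A c))"
    unfolding slit_chart_range[OF M c] using chart_range_open[OF M c] by (intro open_Times) auto
  show "smooth_on (chart_range (slit_chart A c)) L"
    using fin c unfolding finsler_space_def smooth_function_def slit_atlas_def L_def
      finsler_coord_def by auto
  show "y \<noteq> 0 \<Longrightarrow> (x, y) \<in> chart_range (slit_chart A c)"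
    unfolding x_def by (rule slit_chart_inv(2)[OF M c p])
qed

lemma L_pos: "y \<noteq> 0 \<Longrightarrow> 0 < L (x, y)"
  unfolding L_def x_def by (rule finsler_coord_pos[OF fin c p])

lemma L_fibre_derivative:
  assumes "y \<noteq> 0"
  shows "((\<lambda>y. L (x, y)) has_derivative (\<lambda>h. frechet_derivative L (at (x, y)) (0, h))) (at y)"
proof -
  have "Ck_on (Suc 0) (chart_range (slit_chart A c)) L"
    using coord_smooth(2) unfolding smooth_on_def by blast
  then have "(L has_derivative frechet_derivative L (at (x, y))) (at (x, y))"
    using coord_smooth(1,3) assms
    by (simp add: differentiable_on_eq_differentiable_at frechet_derivative_works)
  moreover have "((\<lambda>y. (x, y)) has_derivative (\<lambda>h. (0, h))) (at y)"
    by (auto intro!: derivative_eq_intros)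
  ultimately show ?thesis
    using diff_chain_at[of "\<lambda>y. (x, y)" "\<lambda>h. (0, h)" y L "frechet_derivative L (at (x, y))"]
    by (simp add: o_def)
qed

lemma radial_partial:
  assumes "y \<noteq> 0"
  shows "frechet_derivative (radial L x) (at y) (axis i 1)
    = (1 / L (x, y)) *\<^sub>R axis i 1 - (pdy i L (x, y) / (L (x, y))\<^sup>2) *\<^sub>R y"
proof -
  have "((\<lambda>y. (1 / L (x, y)) *\<^sub>R y) has_derivative
      (\<lambda>h. (1 / L (x, y)) *\<^sub>R h
        - (frechet_derivative L (at (x, y)) (0, h) / (L (x, y))\<^sup>2) *\<^sub>R y)) (at y)"
    using L_pos[OF assms]
    by (auto intro!: derivative_eq_intros L_fibre_derivative[OF assms]
        simp: divide_inverse power2_eq_square fun_eq_iff scaleR_diff_left ac_simps)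
  then have "(radial L x has_derivative
      (\<lambda>h. (1 / L (x, y)) *\<^sub>R h
        - (frechet_derivative L (at (x, y)) (0, h) / (L (x, y))\<^sup>2) *\<^sub>R y)) (at y)"
    by (simp add: radial_def[abs_def])
  from frechet_derivative_at[OF this, symmetric] show ?thesis by (simp only: pdy_def)
qed

lemma radial_nonzero: "y \<noteq> 0 \<Longrightarrow> radial L x y \<noteq> 0"
  using L_pos[of y] by (simp add: radial_def)

lemma L_fibre_continuous:
  "continuous_on (UNIV - {0}) (\<lambda>y. L (x, y))"
  "continuous_on (UNIV - {0}) (\<lambda>y. pdy i L (x, y))"
proof -
  have C: "Ck_on (Suc 0) (chart_range (slit_chart A c)) L"
    using coord_smooth(2) unfolding smooth_on_def by blast
  have L: "continuous_on (chart_range (slit_chart A c)) L"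
    using C by (simp add: differentiable_imp_continuous_on)
  have dL: "continuous_on (chart_range (slit_chart A c)) (pdy i L)"
    using C by (simp add: pdy_def[abs_def])
  show "continuous_on (UNIV - {0}) (\<lambda>y. L (x, y))"
    by (rule continuous_on_compose2[OF L]) (auto intro!: continuous_intros coord_smooth(3))
  show "continuous_on (UNIV - {0}) (\<lambda>y. pdy i L (x, y))"
    by (rule continuous_on_compose2[OF dL]) (auto intro!: continuous_intros coord_smooth(3))
qed

lemma radial_continuous: "continuous_on (UNIV - {0}) (radial L x)"
  unfolding radial_def
  by (intro continuous_intros L_fibre_continuous) (use L_pos in fastforce)

text \<open>The partial derivatives of the radial projection are explicit in \<open>L\<close> and its first fibre
  derivatives (\<open>radial_partial\<close>), and a determinant is a polynomial in its entries.\<close>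

lemma radial_density_continuous: "continuous_on (UNIV - {0}) (radial_density L x k)"
proof -
  have r: "continuous_on (UNIV - {0}) (\<lambda>y. L (x, radial L x y))"
    by (rule continuous_on_compose2[OF L_fibre_continuous(1) radial_continuous])
      (use radial_nonzero in auto)
  have nz: "L (x, y) \<noteq> 0" "L (x, radial L x y) \<noteq> 0" if "y \<in> UNIV - {0}" for y
    using that L_pos[of y] L_pos[OF radial_nonzero, of y] by auto
  have "continuous_on (UNIV - {0}) (\<lambda>y. fund L (x, radial L x y) $ i $ j)" for i j
    by (rule continuous_on_compose2[OF fund_continuous[OF coord_smooth(1,2)]])
      (use radial_nonzero coord_smooth(3) in \<open>auto intro!: continuous_intros radial_continuous\<close>)
  note g = continuous_on_det[OF this]
  let ?W = "\<lambda>y i. (1 / L (x, y)) *\<^sub>R axis i 1 - (pdy i L (x, y) / (L (x, y))\<^sup>2) *\<^sub>R y"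
  let ?B = "\<lambda>y. (\<chi> i. (1 / L (x, radial L x y)) *\<^sub>R
    (if i = k then (1 / L (x, radial L x y)) *\<^sub>R radial L x y else ?W y i)) :: real ^ 'n ^ 'n"
  have "continuous_on (UNIV - {0}) (\<lambda>y. ?B y $ i $ j)" for i j
    by (cases "i = k") (use nz in \<open>auto intro!: continuous_intros r L_fibre_continuous radial_continuous\<close>)
  note continuous_on_det[OF this]
  with g have "continuous_on (UNIV - {0}) (\<lambda>y. \<bar>sqrt (det (fund L (x, radial L x y))) * det (?B y)\<bar>)"
    by (intro continuous_intros)
  moreover have "\<bar>sqrt (det (fund L (x, radial L x y))) * det (?B y)\<bar> = radial_density L x k y"
    if "y \<in> UNIV - {0}" for y
    using that by (simp add: radial_density_def indicatrix_form_vertical radial_partial cong: if_cong)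
  ultimately show ?thesis by (rule continuous_on_eq)
qed

text \<open>Let \<open>B\<close> be the matrix of the form, whose rows are multiples of \<open>y\<close> (row \<open>k\<close>) and of
  \<open>e\<^sub>i / L + \<beta>\<^sub>i y\<close> (rows \<open>i \<noteq> k\<close>). If \<open>B z = 0\<close>, row \<open>k\<close> gives \<open>y \<bullet> z = 0\<close>, then the other rows
  give \<open>z\<^sub>i = 0\<close>, and finally \<open>y\<^sub>k z\<^sub>k = y \<bullet> z = 0\<close> with \<open>y\<^sub>k \<noteq> 0\<close>. So \<open>B\<close> is regular; the
  fundamental tensor is regular because it is positive definite, and the absolute value in the
  density makes the sign of \<open>det B\<close> irrelevant.\<close>

lemma radial_density_pos:
  assumes "y $ k \<noteq> 0"
  shows "0 < radial_density L x k y"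
proof -
  have y: "y \<noteq> 0" using assms by auto
  note u = radial_nonzero[OF y]
  define l where "l = L (x, y)"
  define m where "m = L (x, radial L x y)"
  have lm: "l > 0" "m > 0" using L_pos[OF y] L_pos[OF u] by (auto simp: l_def m_def)
  have "det (fund L (x, radial L x y)) \<noteq> 0"
    by (rule det_nonzero_of_positive)
      (use fin c coord_smooth(3)[OF u] in \<open>auto simp: finsler_space_def L_def\<close>)
  moreover
  let ?W = "\<lambda>i. frechet_derivative (radial L x) (at y) (axis i 1)"
  let ?B = "(\<chi> i. (1 / m) *\<^sub>R (if i = k then (1 / m) *\<^sub>R radial L x y else ?W i)) :: real ^ 'n ^ 'n"
  have "z = 0" if z: "?B *v z = 0" for z
  proof -
    have row: "(if i = k then (1 / m) *\<^sub>R radial L x y else ?W i) \<bullet> z = 0" for i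
      using arg_cong[OF z, of "\<lambda>v. v $ i"] lm
      by (simp add: matrix_vector_mul_component split: if_splits)
    have yz: "y \<bullet> z = 0"
      using row[of k] lm by (simp add: radial_def l_def)
    have zi: "z $ i = 0" if "i \<noteq> k" for i
      using row[of i] that yz lm
      by (simp add: radial_partial[OF y] inner_diff_left inner_axis' l_def)
    have "y \<bullet> z = y $ k * z $ k"
      using zi by (simp add: inner_vec_def sum.remove[of UNIV k])
    then have "z $ k = 0" using yz assms by simp
    with zi show "z = 0" by (metis vec_eq_iff zero_index)
  qed
  then have "det ?B \<noteq> 0"
    using matrix_left_invertible_ker[of ?B] invertible_left_inverse[of ?B] invertible_det_nz[of ?B]
    by blast
  ultimately show ?thesis
    by (simp add: radial_density_def indicatrix_form_vertical m_def cong: if_cong)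
qed

end

section \<open>Averages over the indicatrix\<close>

context
  fixes M :: "'m topology" and A :: "('m, real ^ 'n::finite) chart set" and F p
  assumes fin: "finsler_space M A F" and p: "p \<in> topspace M"
begin

lemma manifold: "smooth_manifold M A"
  using fin by (simp add: finsler_space_def)

lemma point_chart: "chart_at A p \<in> A" "p \<in> fst (chart_at A p)"
proof -
  obtain c where c: "c \<in> A" "p \<in> fst c"
    using manifold p by (auto simp: smooth_manifold_def)
  show "chart_at A p \<in> A" "p \<in> fst (chart_at A p)"
    by (rule chart_at_chart[OF manifold c])+
qed

lemma tvec_of_slit_point:
  assumes "a \<noteq> 0" "c \<in> A" "p \<in> fst c"
  shows "(p, tvec_of A (chart_at A p) p a) \<in> fst (slit_chart A c)"
  using slit_chart_inv(3)[OF manifold point_chart assms(1)] assms(3) by (simp add: slit_chart_def)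

lemma indicatrix_integral_cong:
  assumes "\<And>a. a \<noteq> 0 \<Longrightarrow> f (tvec_of A (chart_at A p) p a) = g (tvec_of A (chart_at A p) p a)"
  shows "indicatrix_integral A F p f = indicatrix_integral A F p g"
proof -
  have "radial (finsler_coord A F (chart_at A p)) (snd (chart_at A p) p)
      (\<chi> i. if i = k then \<sigma> else s i) \<noteq> 0" if "\<sigma> \<in> {-1, 1}" for \<sigma> k s
    by (rule radial_nonzero[OF fin point_chart]) (use that in \<open>auto simp: vec_eq_iff\<close>)
  then show ?thesis
    unfolding indicatrix_integral_radial Let_def using assms
    by (intro sum.cong refl) simp
qed

lemma indicatrix_integrand_integrable:
  fixes f :: "('m, real ^ 'n) tvec \<Rightarrow> 'b::{banach, second_countable_topology}"
  assumes f: "continuous_on (UNIV - {0}) (\<lambda>a. f (tvec_of A (chart_at A p) p a))"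
    and \<sigma>: "\<sigma> \<in> {-1, 1}"
  defines "L \<equiv> finsler_coord A F (chart_at A p)" and "x \<equiv> snd (chart_at A p) p"
  shows "set_integrable (\<Pi>\<^sub>M i\<in>UNIV - {k}. lborel) (UNIV - {k} \<rightarrow>\<^sub>E {-1..1})
    (\<lambda>s. radial_density L x k (\<chi> i. if i = k then \<sigma> else s i)
      *\<^sub>R f (tvec_of A (chart_at A p) p (radial L x (\<chi> i. if i = k then \<sigma> else s i))))"
proof (rule cube_face_integrable[OF _ \<sigma>])
  have "continuous_on (UNIV - {0}) (\<lambda>y. f (tvec_of A (chart_at A p) p (radial L x y)))"
    unfolding L_def x_def
    by (rule continuous_on_compose2[OF f radial_continuous[OF fin point_chart]])
      (use radial_nonzero[OF fin point_chart] in auto)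
  then show "continuous_on (UNIV - {0}) (\<lambda>y. radial_density L x k y
      *\<^sub>R f (tvec_of A (chart_at A p) p (radial L x y)))"
    unfolding L_def x_def
    by (intro continuous_on_scaleR radial_density_continuous[OF fin point_chart])
qed

lemma indicatrix_integral_diff:
  fixes f g :: "('m, real ^ 'n) tvec \<Rightarrow> 'b::{banach, second_countable_topology}"
  assumes "continuous_on (UNIV - {0}) (\<lambda>a. f (tvec_of A (chart_at A p) p a))"
    and "continuous_on (UNIV - {0}) (\<lambda>a. g (tvec_of A (chart_at A p) p a))"
  shows "indicatrix_integral A F p (\<lambda>v. f v - g v)
    = indicatrix_integral A F p f - indicatrix_integral A F p g"
  unfolding indicatrix_integral_radial Let_def sum_subtractf[symmetric] scaleR_diff_right
  by (intro sum.cong refl set_integral_diff(2) indicatrix_integrand_integrable assms)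

lemma indicatrix_integral_const:
  fixes b :: "'b::{banach, second_countable_topology}"
  shows "indicatrix_integral A F p (\<lambda>_. b) = indicatrix_vol A F p *\<^sub>R b"
proof -
  have "(LINT s : (UNIV - {k} \<rightarrow>\<^sub>E {-1..1}) | (\<Pi>\<^sub>M i\<in>UNIV - {k}. lborel).
      radial_density (finsler_coord A F (chart_at A p)) (snd (chart_at A p) p) k
        (\<chi> i. if i = k then \<sigma> else s i) *\<^sub>R b)
    = (LINT s : (UNIV - {k} \<rightarrow>\<^sub>E {-1..1}) | (\<Pi>\<^sub>M i\<in>UNIV - {k}. lborel).
      radial_density (finsler_coord A F (chart_at A p)) (snd (chart_at A p) p) k
        (\<chi> i. if i = k then \<sigma> else s i) *\<^sub>R 1) *\<^sub>R b"
    if \<sigma>: "\<sigma> \<in> {-1, 1}" for \<sigma> k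
    using indicatrix_integrand_integrable[of "\<lambda>_. 1::real", OF _ \<sigma>, of k]
    unfolding set_lebesgue_integral_def set_integrable_def
    by (subst integral_scaleR_left[symmetric]) simp_all
  then show ?thesis
    unfolding indicatrix_vol_def indicatrix_integral_radial Let_def scaleR_sum_left
    by (intro sum.cong refl)
qed

lemma indicatrix_vol_pos: "0 < indicatrix_vol A F p"
proof -
  have "0 < (LINT s : (UNIV - {k} \<rightarrow>\<^sub>E {-1..1}) | (\<Pi>\<^sub>M i\<in>UNIV - {k}. lborel).
      radial_density (finsler_coord A F (chart_at A p)) (snd (chart_at A p) p) k
        (\<chi> i. if i = k then \<sigma> else s i) *\<^sub>R (1 :: real))" if \<sigma>: "\<sigma> \<in> {-1, 1}" for \<sigma> k
  proof -
    have "0 < radial_density (finsler_coord A F (chart_at A p)) (snd (chart_at A p) p) k y"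
      if "y $ k = \<sigma>" for y
      by (rule radial_density_pos[OF fin point_chart]) (use that \<sigma> in auto)
    then show ?thesis unfolding real_scaleR_def mult_1_right
      by (intro cube_face_integral_pos[OF radial_density_continuous[OF fin point_chart] \<sigma>])
  qed
  then show ?thesis
    unfolding indicatrix_vol_def indicatrix_integral_radial Let_def
    by (intro sum_pos) auto
qed

text \<open>Continuity makes both functions integrable; the integral of a non-integrable function is \<open>0\<close> by
  convention, so the difference could not be taken under the integral otherwise.\<close>

lemma indicatrix_average_diff:
  fixes f g :: "('m, real ^ 'n) tvec \<Rightarrow> 'b::{banach, second_countable_topology}"
  assumes "continuous_on (UNIV - {0}) (\<lambda>a. f (tvec_of A (chart_at A p) p a))"
    and "continuous_on (UNIV - {0}) (\<lambda>a. g (tvec_of A (chart_at A p) p a))"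
    and diff: "\<And>a. a \<noteq> 0 \<Longrightarrow>
      f (tvec_of A (chart_at A p) p a) - g (tvec_of A (chart_at A p) p a) = b"
  shows "indicatrix_average A F p f - indicatrix_average A F p g = b"
proof -
  have "indicatrix_integral A F p f - indicatrix_integral A F p g
      = indicatrix_integral A F p (\<lambda>_. b)"
    unfolding indicatrix_integral_diff[OF assms(1,2), symmetric]
    using diff by (rule indicatrix_integral_cong)
  then have "indicatrix_integral A F p f - indicatrix_integral A F p g = indicatrix_vol A F p *\<^sub>R b"
    by (simp only: indicatrix_integral_const)
  then show ?thesis
    using indicatrix_vol_pos
    by (simp add: indicatrix_average_def flip: scaleR_diff_right)
qed

end

section \<open>The average connection is torsion-free\<close>

theorem corollary4p5:
  fixes M :: "'m topology"
    and A :: "('m, real ^ 'n::finite) chart set"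
    and F :: "('m, real ^ 'n) tpoint \<Rightarrow> real"
    and D :: "('m, real ^ 'n) pbconn"
    and X Y :: "'m \<Rightarrow> ('m, real ^ 'n) tvec"
    and p :: 'm
  assumes "finsler_space M A F"
    and "chern_rund_connection A F D"
    and "smooth_vector_field A X"
    and "smooth_vector_field A Y"
    and "p \<in> topspace M"
  shows "torsion A (average_connection A F D) X Y p = (\<lambda>c. 0)"
proof
  fix c
  have M: "smooth_manifold M A" using assms(1) by (simp add: finsler_space_def)
  note pt = point_chart[OF assms(1,5)]
  note slit = tvec_of_slit_point[OF assms(1,5)]
  let ?v = "tvec_of A (chart_at A p) p"
  let ?D = "\<lambda>X Y v. D (p, v) (horizontal_lift A F (p, v) (X p)) (\<lambda>u. Y (fst u)) c"
  have tangent: "Z p \<in> tangent_space A p" if "smooth_vector_field A Z" for Z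
    using that pt by (auto simp: smooth_vector_field_def carrier_of_def)
  have "indicatrix_average A F p (?D X Y) - indicatrix_average A F p (?D Y X)
      = lie_bracket A X Y p c"
  proof (cases "c \<in> A \<and> p \<in> fst c")
    case True
    then have c: "c \<in> A" and p: "p \<in> fst c" by auto
    obtain \<Gamma> where cont: "\<And>i j \<xi>. continuous_on (chart_range (slit_chart A c)) (\<lambda>w. \<Gamma> i j w \<xi>)"
      and sym: "\<And>i w \<xi> \<eta>. w \<in> chart_range (slit_chart A c) \<Longrightarrow>
        (\<Sum>j\<in>UNIV. \<Gamma> i j w \<xi> * \<eta> $ j) = (\<Sum>j\<in>UNIV. \<Gamma> i j w \<eta> * \<xi> $ j)"
      and D: "\<And>u X Y. u \<in> fst (slit_chart A c) \<Longrightarrow> X \<in> tangent_space A (fst u) \<Longrightarrow>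
        smooth_vector_field A Y \<Longrightarrow>
        D u (horizontal_lift A F u X) (\<lambda>w. Y (fst w)) c =
          frechet_derivative (\<lambda>x. Y (chart_inv c x) c) (at (snd c (fst u))) (X c)
          + (\<chi> i. \<Sum>j\<in>UNIV. \<Gamma> i j (snd (slit_chart A c) u) (X c) * Y (fst u) c $ j)"
      using chern_rund_coefficients[OF M assms(2) c] by blast
    have range: "(snd c p, ?v a c) \<in> chart_range (slit_chart A c)" if "a \<noteq> 0" for a
      using slit[OF that c p] by (force simp: chart_range_def slit_chart_def)
    have Dv: "?D Z W (?v a) = frechet_derivative (\<lambda>x. W (chart_inv c x) c) (at (snd c p)) (Z p c)
        + (\<chi> i. \<Sum>j\<in>UNIV. \<Gamma> i j (snd c p, ?v a c) (Z p c) * W p c $ j)"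
      if "smooth_vector_field A Z" "smooth_vector_field A W" "a \<noteq> 0" for Z W a
      using D[OF slit[OF that(3) c p], of "Z p" W] tangent[OF that(1)] that(2)
      by (simp add: slit_chart_def)
    have "bounded_linear (\<lambda>a. ?v a c)"
      using transition_has_derivative[OF M pt(1) c pt(2) p] c p
      by (simp add: tvec_of_def has_derivative_bounded_linear)
    then have "continuous_on (UNIV - {0}) (\<lambda>a. (snd c p, ?v a c))"
      by (intro continuous_intros linear_continuous_on)
    then have "continuous_on (UNIV - {0}) (\<lambda>a. \<Gamma> i j (snd c p, ?v a c) \<xi>)" for i j \<xi>
      by (rule continuous_on_compose2[OF cont]) (use range in auto)
    then have "continuous_on (UNIV - {0})
        (\<lambda>a. frechet_derivative (\<lambda>x. W (chart_inv c x) c) (at (snd c p)) (Z p c)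
          + (\<chi> i. \<Sum>j\<in>UNIV. \<Gamma> i j (snd c p, ?v a c) (Z p c) * W p c $ j))" for Z W
      by (intro continuous_intros)
    then have contD: "continuous_on (UNIV - {0}) (\<lambda>a. ?D Z W (?v a))"
      if "smooth_vector_field A Z" "smooth_vector_field A W" for Z W
      by (rule continuous_on_eq) (simp add: Dv[OF that])
    show ?thesis
    proof (rule indicatrix_average_diff[OF assms(1,5) contD[OF assms(3,4)] contD[OF assms(4,3)]])
      fix a :: "real ^ 'n" assume a: "a \<noteq> 0"
      show "?D X Y (?v a) - ?D Y X (?v a) = lie_bracket A X Y p c"
        unfolding Dv[OF assms(3,4) a] Dv[OF assms(4,3) a] sym[OF range[OF a], of _ "X p c"]
        using c p by (simp add: lie_bracket_def)
    qed
  next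
    \<comment> \<open>In an index \<open>c\<close> that is not a chart around \<open>p\<close>, tangent vectors have the default component \<open>0\<close>.\<close>
    case False
    have "?D Z W (?v a) = 0"
      if "smooth_vector_field A Z" "smooth_vector_field A W" "a \<noteq> 0" for Z W a
    proof -
      have u: "(p, ?v a) \<in> fst (slit_chart A (chart_at A p))" by (rule slit[OF that(3) pt])
      then have "(p, ?v a) \<in> carrier_of (slit_atlas A)"
        using pt by (auto simp: carrier_of_def slit_atlas_def)
      then have "D (p, ?v a) (horizontal_lift A F (p, ?v a) (Z p)) (\<lambda>u. W (fst u))
          \<in> tangent_space A p"
        using assms(2) smooth_section_pullback[OF M that(2)]
          horizontal_lift(1)[OF M pt(1) u] tangent[OF that(1)]
        unfolding chern_rund_connection_def linear_connection_def by fastforce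
      then show ?thesis using False unfolding tangent_space_def by blast
    qed
    moreover have "indicatrix_average A F p f = 0"
      if "\<And>a. a \<noteq> 0 \<Longrightarrow> f (?v a) = 0" for f :: "('m, real ^ 'n) tvec \<Rightarrow> real ^ 'n"
      using indicatrix_average_diff[OF assms(1,5), of f f 0] that
        indicatrix_integral_cong[OF assms(1,5), of f "\<lambda>_. 0"]
        indicatrix_integral_const[OF assms(1,5), of "0 :: real ^ 'n"]
      by (simp add: indicatrix_average_def)
    ultimately show ?thesis using assms(3,4) False by (auto simp: lie_bracket_def)
  qed
  then show "torsion A (average_connection A F D) X Y p c = 0"
    by (simp add: torsion_def average_connection_def)
qed

end
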